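(* Let $\alpha,\beta\in\mathbb{R}$ with $3\alpha+\beta\neq0$, and let $(V,g)$ be a 4-dimensional static spherically symmetric space-time in Schwarzschild form which is $A$-flat (i.e. $A_g=0$ for the parameters $\alpha,\beta$). Then: - If $\beta=0$, then $g$ is either a Schwarzschild–de Sitter (or Schwarzschild–anti-de Sitter) metric or a Reissner–Nordström metric, meaning that either $$g=-\left(1-\frac mr-\frac\Lambda3r^2\right)dt^2+\frac{1}{1-\frac mr-\frac\Lambda3r^2}dr^2+r^2d\Omega^2$$ for some constants $m,\Lambda$, or $$g=-\left(1-\frac{r_0}{r}-\frac{r_Q}{r^2}\right)dt^2+\frac{1}{1-\frac{r_0}{r}-\frac{r_Q}{r^2}}dr^2+r^2d\Omega^2$$ for some constants $r_0,r_Q$. - If $\beta\neq0$, then $g$ is a Schwarzschild–de Sitter (or Schwarzschild–anti-de Sitter) metric, i.e. of the first form above for some constants $m,\Lambda$.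
   Context: A static spherically symmetric space-time here is $V=I\times\mathbb{S}^2\times\mathbb{R}$, with $I\subset(0,\infty)$ an interval (coordinate $r$), $t$ the coordinate on $\mathbb{R}$, and metric $-a(r)^2dt^2+b(r)^2dr^2+r^2d\Omega^2$ with $a,b>0$, where $d\Omega^2$ is the standard round metric on $\mathbb{S}^2$. It is in Schwarzschild form if $a(r)b(r)=1$. For a Lorentzian metric $g$ and real parameters $\alpha,\beta$, $$A_{g}=\beta\Box_{g}\mathrm{Ric}_{g}+\left(\tfrac12\beta+2\alpha\right)\Box_{g}R_{g}\,g-(2\alpha+\beta)\nabla^2R_{g}+2\beta\,\mathrm{Ric}_{g}\cdot\mathrm{Riem}_{g}+2\alpha R_{g}\mathrm{Ric}_{g}-\tfrac12\alpha R_{g}^2\,g-\tfrac12\beta\langle\mathrm{Ric}_{g},\mathrm{Ric}_{g}\rangle_{g}\,g,$$ where $\Box_g=g^{\mu\nu}\nabla_\mu\nabla_\nu$, $(\mathrm{Ric}\cdot\mathrm{Riem})_{\mu\nu}=\mathrm{Riem}^{\tau}{}_{\mu\lambda\nu}\mathrm{Ric}^{\lambda}{}_{\tau}$, $R(X,Y)Z=\nabla_X\nabla_YZ-\nabla_Y\nabla_XZ-\nabla_{[X,Y]}Z$, $R^i{}_{jkl}=dx^i(R(\partial_k,\partial_l)\partial_j)$, $\mathrm{Ric}_{ij}=R^l{}_{ilj}$. *)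

theory Defs
  imports "HOL-Analysis.Analysis"
begin

text \<open>
  Metrics are given by their component matrices in a coordinate chart, i.e. as functions
  from points of \<open>real ^ 'n\<close> to matrices; the definitions are meaningful on an open
  set on which the metric is smooth and nondegenerate.
\<close>

type_synonym 'n metric = "real ^ 'n \<Rightarrow> real ^ 'n ^ 'n"
type_synonym 'n vfield = "real ^ 'n \<Rightarrow> real ^ 'n"

definition pd :: "'n::finite \<Rightarrow> (real ^ 'n \<Rightarrow> real) \<Rightarrow> real ^ 'n \<Rightarrow> real" where
  "pd i f x = deriv (\<lambda>h. f (x + h *\<^sub>R axis i 1)) 0"

definition ginv :: "'n::finite metric \<Rightarrow> 'n \<Rightarrow> 'n \<Rightarrow> real ^ 'n \<Rightarrow> real" where
  "ginv g i j x = matrix_inv (g x) $ i $ j"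

definition christoffel :: "'n::finite metric \<Rightarrow> 'n \<Rightarrow> 'n \<Rightarrow> 'n \<Rightarrow> real ^ 'n \<Rightarrow> real" where
  \<comment> \<open>\<open>christoffel g k i j\<close> has upper index \<open>k\<close>\<close>
  "christoffel g k i j x =
     (\<Sum>l\<in>UNIV. ginv g k l x *
        (pd i (\<lambda>y. g y $ j $ l) x + pd j (\<lambda>y. g y $ i $ l) x - pd l (\<lambda>y. g y $ i $ j) x)) / 2"

definition nabla :: "'n::finite metric \<Rightarrow> 'n vfield \<Rightarrow> 'n vfield \<Rightarrow> 'n vfield" where
  \<comment> \<open>Levi-Civita derivative of \<open>Y\<close> in direction \<open>X\<close>\<close>
  "nabla g X Y x = (\<chi> k. (\<Sum>i\<in>UNIV. X x $ i * pd i (\<lambda>y. Y y $ k) x) +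
     (\<Sum>i\<in>UNIV. \<Sum>j\<in>UNIV. christoffel g k i j x * X x $ i * Y x $ j))"

definition lie_bracket :: "'n::finite vfield \<Rightarrow> 'n vfield \<Rightarrow> 'n vfield" where
  "lie_bracket X Y x = (\<chi> k. \<Sum>i\<in>UNIV.
     X x $ i * pd i (\<lambda>y. Y y $ k) x - Y x $ i * pd i (\<lambda>y. X y $ k) x)"

definition curvature ::
    "'n::finite metric \<Rightarrow> 'n vfield \<Rightarrow> 'n vfield \<Rightarrow> 'n vfield \<Rightarrow> 'n vfield" where
  "curvature g X Y Z x =
     nabla g X (nabla g Y Z) x - nabla g Y (nabla g X Z) x - nabla g (lie_bracket X Y) Z x"

definition coord_field :: "'n::finite \<Rightarrow> 'n vfield" where
  "coord_field i x = axis i 1"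

definition riem ::
    "'n::finite metric \<Rightarrow> 'n \<Rightarrow> 'n \<Rightarrow> 'n \<Rightarrow> 'n \<Rightarrow> real ^ 'n \<Rightarrow> real" where
  \<comment> \<open>\<open>riem g i j k l\<close> has upper index \<open>i\<close>\<close>
  "riem g i j k l x = curvature g (coord_field k) (coord_field l) (coord_field j) x $ i"

definition ric :: "'n::finite metric \<Rightarrow> 'n \<Rightarrow> 'n \<Rightarrow> real ^ 'n \<Rightarrow> real" where
  "ric g i j x = (\<Sum>l\<in>UNIV. riem g l i l j x)"

definition ric_mixed :: "'n::finite metric \<Rightarrow> 'n \<Rightarrow> 'n \<Rightarrow> real ^ 'n \<Rightarrow> real" where
  \<comment> \<open>first index raised\<close>
  "ric_mixed g i j x = (\<Sum>k\<in>UNIV. ginv g i k x * ric g k j x)"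

definition scal :: "'n::finite metric \<Rightarrow> real ^ 'n \<Rightarrow> real" where
  "scal g x = (\<Sum>i\<in>UNIV. \<Sum>j\<in>UNIV. ginv g i j x * ric g i j x)"

text \<open>
  Covariant derivatives of covariant tensors of rank 1, 2, 3, given by their components.
  The new index comes first: \<open>cov2 g T k i j\<close> is the component
  \<open>(\<nabla>\<^sub>k T)\<^sub>i\<^sub>j\<close>.
\<close>

definition cov1 :: "'n::finite metric \<Rightarrow> ('n \<Rightarrow> real ^ 'n \<Rightarrow> real) \<Rightarrow>
    'n \<Rightarrow> 'n \<Rightarrow> real ^ 'n \<Rightarrow> real" where
  "cov1 g T k i x = pd k (T i) x - (\<Sum>m\<in>UNIV. christoffel g m k i x * T m x)"

definition cov2 :: "'n::finite metric \<Rightarrow> ('n \<Rightarrow> 'n \<Rightarrow> real ^ 'n \<Rightarrow> real) \<Rightarrow>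
    'n \<Rightarrow> 'n \<Rightarrow> 'n \<Rightarrow> real ^ 'n \<Rightarrow> real" where
  "cov2 g T k i j x = pd k (T i j) x
     - (\<Sum>m\<in>UNIV. christoffel g m k i x * T m j x)
     - (\<Sum>m\<in>UNIV. christoffel g m k j x * T i m x)"

definition cov3 :: "'n::finite metric \<Rightarrow> ('n \<Rightarrow> 'n \<Rightarrow> 'n \<Rightarrow> real ^ 'n \<Rightarrow> real) \<Rightarrow>
    'n \<Rightarrow> 'n \<Rightarrow> 'n \<Rightarrow> 'n \<Rightarrow> real ^ 'n \<Rightarrow> real" where
  "cov3 g T l k i j x = pd l (T k i j) x
     - (\<Sum>m\<in>UNIV. christoffel g m l k x * T m i j x)
     - (\<Sum>m\<in>UNIV. christoffel g m l i x * T k m j x)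
     - (\<Sum>m\<in>UNIV. christoffel g m l j x * T k i m x)"

definition hess :: "'n::finite metric \<Rightarrow> (real ^ 'n \<Rightarrow> real) \<Rightarrow>
    'n \<Rightarrow> 'n \<Rightarrow> real ^ 'n \<Rightarrow> real" where
  "hess g f = cov1 g (\<lambda>i. pd i f)"

definition box0 :: "'n::finite metric \<Rightarrow> (real ^ 'n \<Rightarrow> real) \<Rightarrow> real ^ 'n \<Rightarrow> real" where
  "box0 g f x = (\<Sum>k\<in>UNIV. \<Sum>l\<in>UNIV. ginv g k l x * hess g f k l x)"

definition box2 :: "'n::finite metric \<Rightarrow> ('n \<Rightarrow> 'n \<Rightarrow> real ^ 'n \<Rightarrow> real) \<Rightarrow>
    'n \<Rightarrow> 'n \<Rightarrow> real ^ 'n \<Rightarrow> real" where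
  "box2 g T i j x =
     (\<Sum>k\<in>UNIV. \<Sum>l\<in>UNIV. ginv g k l x * cov3 g (cov2 g T) k l i j x)"

definition ric_riem :: "'n::finite metric \<Rightarrow> 'n \<Rightarrow> 'n \<Rightarrow> real ^ 'n \<Rightarrow> real" where
  "ric_riem g i j x =
     (\<Sum>k\<in>UNIV. \<Sum>l\<in>UNIV. riem g k i l j x * ric_mixed g l k x)"

definition ric_norm2 :: "'n::finite metric \<Rightarrow> real ^ 'n \<Rightarrow> real" where
  "ric_norm2 g x = (\<Sum>i\<in>UNIV. \<Sum>j\<in>UNIV. \<Sum>k\<in>UNIV. \<Sum>l\<in>UNIV.
     ginv g i k x * ginv g j l x * ric g i j x * ric g k l x)"

definition A_tensor ::
    "real \<Rightarrow> real \<Rightarrow> 'n::finite metric \<Rightarrow> 'n \<Rightarrow> 'n \<Rightarrow> real ^ 'n \<Rightarrow> real" where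
  "A_tensor \<alpha> \<beta> g i j x =
     \<beta> * box2 g (ric g) i j x
     + (\<beta> / 2 + 2 * \<alpha>) * box0 g (scal g) x * g x $ i $ j
     - (2 * \<alpha> + \<beta>) * hess g (scal g) i j x
     + 2 * \<beta> * ric_riem g i j x
     + 2 * \<alpha> * scal g x * ric g i j x
     - \<alpha> / 2 * (scal g x)\<^sup>2 * g x $ i $ j
     - \<beta> / 2 * ric_norm2 g x * g x $ i $ j"

definition A_flat_on :: "real \<Rightarrow> real \<Rightarrow> (real ^ 'n) set \<Rightarrow> 'n::finite metric \<Rightarrow> bool" where
  "A_flat_on \<alpha> \<beta> S g \<longleftrightarrow> (\<forall>x\<in>S. \<forall>i j. A_tensor \<alpha> \<beta> g i j x = 0)"

text \<open>
  Static spherically symmetric metrics on \<open>I \<times> S\<^sup>2 \<times> \<real>\<close>, in the coordinates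
  \<open>(x $ 1, x $ 2, x $ 3, x $ 4) = (t, r, \<theta>, \<phi>)\<close>, where \<open>\<theta>, \<phi>\<close> are
  spherical coordinates on the sphere minus a closed half great circle. The domains of the
  spherical coordinate systems with respect to arbitrary rotated axes cover the sphere, and
  the metric has the same components in each of them. Since \<open>A\<close> is a tensor, its
  vanishing on the whole space-time is therefore the same as its vanishing on this chart, and
  likewise equality of two such metrics may be tested on this chart. (The index type
  \<open>4\<close> has the elements 1, 2, 3 and 4, the last of which is equal to 0.)
\<close>

definition sph_chart :: "real set \<Rightarrow> (real ^ 4) set" where
  "sph_chart I = {x. x $ 2 \<in> I \<and> 0 < x $ 3 \<and> x $ 3 < pi \<and> - pi < x $ 4 \<and> x $ 4 < pi}"

definition sph_metric :: "(real \<Rightarrow> real) \<Rightarrow> (real \<Rightarrow> real) \<Rightarrow> 4 metric" where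
  \<comment> \<open>\<open>- P(r) dt\<^sup>2 + Q(r) dr\<^sup>2 + r\<^sup>2 (d\<theta>\<^sup>2 + sin\<^sup>2 \<theta> d\<phi>\<^sup>2)\<close>\<close>
  "sph_metric P Q x = (\<chi> i j.
     if i \<noteq> j then 0
     else if i = 1 then - P (x $ 2)
     else if i = 2 then Q (x $ 2)
     else if i = 3 then (x $ 2)\<^sup>2
     else (x $ 2)\<^sup>2 * (sin (x $ 3))\<^sup>2)"

definition smooth_fun_on :: "real set \<Rightarrow> (real \<Rightarrow> real) \<Rightarrow> bool" where
  \<comment> \<open>only used for open sets\<close>
  "smooth_fun_on I f \<longleftrightarrow> (\<forall>k. \<forall>r\<in>I. (deriv ^^ k) f field_differentiable at r)"

definition static_spherical :: "real set \<Rightarrow> (real \<Rightarrow> real) \<Rightarrow> (real \<Rightarrow> real) \<Rightarrow> bool" where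
  "static_spherical I a b \<longleftrightarrow>
     open I \<and> is_interval I \<and> I \<noteq> {} \<and> I \<subseteq> {0<..} \<and>
     smooth_fun_on I a \<and> smooth_fun_on I b \<and> (\<forall>r\<in>I. a r > 0 \<and> b r > 0)"

definition static_spherical_metric :: "(real \<Rightarrow> real) \<Rightarrow> (real \<Rightarrow> real) \<Rightarrow> 4 metric" where
  "static_spherical_metric a b = sph_metric (\<lambda>r. (a r)\<^sup>2) (\<lambda>r. (b r)\<^sup>2)"

definition schwarzschild_form :: "real set \<Rightarrow> (real \<Rightarrow> real) \<Rightarrow> (real \<Rightarrow> real) \<Rightarrow> bool" where
  "schwarzschild_form I a b \<longleftrightarrow> (\<forall>r\<in>I. a r * b r = 1)"

definition schwarzschild_de_sitter_metric :: "real \<Rightarrow> real \<Rightarrow> 4 metric" where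
  "schwarzschild_de_sitter_metric m \<Lambda> =
     sph_metric (\<lambda>r. 1 - m / r - \<Lambda> / 3 * r\<^sup>2) (\<lambda>r. 1 / (1 - m / r - \<Lambda> / 3 * r\<^sup>2))"

definition reissner_nordstrom_metric :: "real \<Rightarrow> real \<Rightarrow> 4 metric" where
  "reissner_nordstrom_metric r0 rQ =
     sph_metric (\<lambda>r. 1 - r0 / r - rQ / r\<^sup>2) (\<lambda>r. 1 / (1 - r0 / r - rQ / r\<^sup>2))"

end

theory Submission
  imports Defs
begin

text \<open>
  Write \<open>f = a\<^sup>2\<close>. In Schwarzschild form the Ricci tensor is diagonal, with one eigenvalue \<open>p\<close> on
  the \<open>(t, r)\<close>-plane and one eigenvalue \<open>q\<close> on the spheres. The contracted Bianchi identity is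
  \<open>q' = 2 (p - q) / r\<close>, and \<open>R = 2 p + 2 q\<close>. The components of the tensor \<open>A\<close> in these
  terms (\<open>A_components\<close>) have three consequences:

  \<^item> The trace is \<open>2 (3 \<alpha> + \<beta>) \<box>R\<close>. Hence \<open>R\<close> is harmonic, that is, \<open>r\<^sup>2 f R'\<close> is a constant \<open>C\<close>.

  \<^item> The difference of the \<open>tt\<close> and \<open>rr\<close> components, in which most terms cancel because
  \<open>p\<close> is a double eigenvalue, is \<open>(2 \<alpha> + \<beta>) R'' = - 4 \<beta> (p - q) / r\<^sup>2\<close>.

  \<^item> For \<open>\<beta> = 0\<close> and constant \<open>R\<close>, what remains is \<open>\<alpha> R (p - q) = 0\<close>.

  It suffices to show that \<open>R\<close> is constant, i.e. \<open>C = 0\<close>. For \<open>\<beta> \<noteq> 0\<close> the second equation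
  then says \<open>p = q\<close>. So \<open>g\<close> is an Einstein metric, and two integrations give
  Schwarzschild--de Sitter (\<open>einstein_profile\<close>). For \<open>\<beta> = 0\<close> the third equation says that \<open>g\<close>
  is Einstein or \<open>R = 0\<close>; in the latter case \<open>r\<^sup>2 (1 - f)\<close> is an affine function, which is the
  Reissner--Nordstroem form (\<open>scalar_flat_profile\<close>).

  If \<open>\<beta> = 0\<close>, then \<open>R'\<close> is constant; were it nonzero, \<open>f\<close> would be a multiple of \<open>r\<^sup>-\<^sup>2\<close>;
  but then \<open>R = 2 / r\<^sup>2\<close>, and \<open>R'\<close> is not constant (\<open>scal_constant_of_affine\<close>).

  If \<open>\<beta> \<noteq> 0\<close> and \<open>2 \<alpha> + \<beta> = 0\<close>, the second equation gives \<open>p = q\<close> at once. The main case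
  is \<open>R'' = \<kappa> (p - q) / r\<^sup>2\<close> with \<open>\<kappa> \<noteq> 0\<close> (\<open>scal_constant_of_coupled\<close>). Differentiating once more
  and using the Bianchi identity shows that \<open>R'\<close> satisfies a linear Euler equation. Its solutions may be
  sums of two powers with real or complex exponents, or involve logarithms; to avoid these cases,
  the logarithmic derivative \<open>y = r R'' / R'\<close> is used, which satisfies an autonomous Riccati equation
  with respect to \<open>log r\<close>. Since \<open>f = C / (r\<^sup>2 R')\<close>, both \<open>r f'\<close> and \<open>r\<^sup>2 f''\<close> are \<open>f\<close> times a polynomial
  in \<open>y\<close>, and the definition of \<open>p - q\<close> turns into an algebraic relation between \<open>r\<close>, \<open>f\<close> and
  \<open>y\<close>. A first differentiation eliminates \<open>r\<close>, a second one eliminates \<open>f\<close>, and leaves a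
  nonzero polynomial equation for \<open>y\<close> with constant coefficients. By continuity \<open>y\<close> is constant, and the
  few constant values that the equations admit are excluded one by one (\<open>no_scaling_solution\<close>).
\<close>

section \<open>Tensor components in a coordinate chart\<close>

lemma matrix_inv_eqI:
  fixes A B :: "real ^ 'n ^ 'n"
  assumes "A ** B = mat 1" "B ** A = mat 1"
  shows "matrix_inv A = B"
proof -
  have "A ** matrix_inv A = mat 1 \<and> matrix_inv A ** A = mat 1"
    unfolding matrix_inv_def by (rule someI[of _ B]) (use assms in simp)
  then show ?thesis
    using assms(2) matrix_mul_assoc[of B A "matrix_inv A"]
    by (simp add: matrix_mul_lid matrix_mul_rid)
qed

lemma ginv_diagonal:
  assumes "\<And>i j. g x $ i $ j = (if i = j then d i else 0)" "\<And>i. d i \<noteq> 0"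
  shows "ginv g i j x = (if i = j then 1 / d i else 0)"
proof -
  have "matrix_inv (g x) = (\<chi> i j. if i = j then 1 / d i else 0)"
    using assms(2)
    by (intro matrix_inv_eqI)
      (simp_all add: matrix_matrix_mult_def mat_def vec_eq_iff assms(1) if_distribR
        if_distrib[of "(*) _"] cong: if_cong)
  then show ?thesis by (simp add: ginv_def)
qed

lemma pd_const: "pd i (\<lambda>x. c) x = 0"
  by (simp add: pd_def)

lemma nabla_coord_field:
  "nabla g (coord_field k) Y x $ i =
     pd k (\<lambda>y. Y y $ i) x + (\<Sum>j\<in>UNIV. christoffel g i k j x * Y x $ j)"
proof -
  have "(\<Sum>l\<in>UNIV. \<Sum>j\<in>UNIV. christoffel g i l j x * axis k 1 $ l * Y x $ j)
    = (\<Sum>l\<in>UNIV. if l = k then \<Sum>j\<in>UNIV. christoffel g i l j x * Y x $ j else 0)"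
    by (intro sum.cong) (auto simp: axis_def)
  moreover have "(\<Sum>l\<in>UNIV. axis k 1 $ l * pd l (\<lambda>y. Y y $ i) x)
    = (\<Sum>l\<in>UNIV. if l = k then pd l (\<lambda>y. Y y $ i) x else 0)"
    by (intro sum.cong) (auto simp: axis_def)
  ultimately show ?thesis
    by (simp add: nabla_def coord_field_def)
qed

lemma nabla_coord_fields:
  "nabla g (coord_field k) (coord_field j) x $ i = christoffel g i k j x"
proof -
  have "(\<Sum>l\<in>UNIV. christoffel g i k l x * axis j 1 $ l)
    = (\<Sum>l\<in>UNIV. if l = j then christoffel g i k l x else 0)"
    by (intro sum.cong) (auto simp: axis_def)
  then show ?thesis
    by (simp add: nabla_coord_field coord_field_def pd_const)
qed

text \<open>
  The Lie bracket of coordinate fields vanishes, so the invariant definition of the curvature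
  reduces to the classical expression in Christoffel symbols.
\<close>

lemma riem_christoffel:
  "riem g i j k l x = pd k (christoffel g i l j) x - pd l (christoffel g i k j) x
     + (\<Sum>m\<in>UNIV. christoffel g i k m x * christoffel g m l j x
         - christoffel g i l m x * christoffel g m k j x)"
proof -
  have "lie_bracket (coord_field k) (coord_field l) = (\<lambda>_. 0)"
    by (simp add: fun_eq_iff lie_bracket_def coord_field_def pd_const vec_eq_iff)
  moreover have "nabla g (\<lambda>_. 0) Z x = 0" for Z
    by (simp add: nabla_def vec_eq_iff)
  ultimately show ?thesis
    unfolding riem_def curvature_def
    by (simp add: nabla_coord_field[of g _ "nabla g _ _"] nabla_coord_fields sum_subtractf)
qed

lemma open_sph_chart:
  assumes "open I"
  shows "open (sph_chart I)"
proof -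
  have "sph_chart I = (\<lambda>x. x $ 2) -` I \<inter> (\<lambda>x. x $ 3) -` {0<..<pi} \<inter> (\<lambda>x. x $ 4) -` {-pi<..<pi}"
    by (auto simp: sph_chart_def)
  moreover have "open ((\<lambda>x::real^4. x $ i) -` T)" if "open T" for i T
    using that by (intro open_vimage) (auto intro!: continuous_intros)
  ultimately show ?thesis
    using assms by (simp add: open_Int)
qed

text \<open>
  All components that have to be differentiated below are products of a function of \<open>r\<close> and a
  function of \<open>\<theta>\<close>, so this is the only rule needed for partial derivatives. The product form has to
  hold on the chart only, because the chart is open.
\<close>

lemma pd_separated:
  assumes "open I" and x: "x \<in> sph_chart I"
    and F: "\<And>y. y \<in> sph_chart I \<Longrightarrow> F y = \<phi> (y $ 2) * \<psi> (y $ 3)"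
    and \<phi>': "(\<phi> has_real_derivative \<phi>') (at (x $ 2))"
    and \<psi>': "(\<psi> has_real_derivative \<psi>') (at (x $ 3))"
  shows "pd i F x = (if i = 2 then \<phi>' * \<psi> (x $ 3) else if i = 3 then \<phi> (x $ 2) * \<psi>' else 0)"
proof -
  define T where "T = (\<lambda>h. x + h *\<^sub>R axis i 1) -` sph_chart I"
  have "open T"
    unfolding T_def by (intro open_vimage open_sph_chart assms(1)) (auto intro!: continuous_intros)
  moreover have "0 \<in> T"
    using x by (simp add: T_def)
  moreover have "\<phi> ((x + h *\<^sub>R axis i 1) $ 2) * \<psi> ((x + h *\<^sub>R axis i 1) $ 3) = F (x + h *\<^sub>R axis i 1)"
    if "h \<in> T" for h
    using that F by (simp add: T_def)
  moreover have "((\<lambda>h. \<phi> ((x + h *\<^sub>R axis i 1) $ 2) * \<psi> ((x + h *\<^sub>R axis i 1) $ 3))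
     has_real_derivative
     (if i = 2 then \<phi>' * \<psi> (x $ 3) else if i = 3 then \<phi> (x $ 2) * \<psi>' else 0)) (at 0)"
  proof -
    have "((\<lambda>h. \<phi> (x $ 2 + h)) has_real_derivative \<phi>') (at 0)"
      "((\<lambda>h. \<psi> (x $ 3 + h)) has_real_derivative \<psi>') (at 0)"
      using \<phi>' \<psi>' DERIV_shift[of \<phi> \<phi>' 0 "x $ 2"] DERIV_shift[of \<psi> \<psi>' 0 "x $ 3"]
      by (simp_all add: add.commute)
    then show ?thesis
      using DERIV_cmult_right[of "\<lambda>h. \<phi> (x $ 2 + h)" \<phi>' 0 UNIV "\<psi> (x $ 3)"]
        DERIV_cmult[of "\<lambda>h. \<psi> (x $ 3 + h)" \<psi>' 0 UNIV "\<phi> (x $ 2)"]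
      by (auto simp: axis_def)
  qed
  ultimately show ?thesis
    unfolding pd_def by (intro DERIV_imp_deriv) (rule has_field_derivative_transform_within_open)
qed

section \<open>Derivatives on an interval\<close>

text \<open>
  Tables of components are case distinctions on indices; they are differentiated entry by entry.
\<close>

lemma DERIV_if:
  assumes "c \<Longrightarrow> (F has_real_derivative F') (at x)"
    and "\<not> c \<Longrightarrow> (G has_real_derivative G') (at x)"
  shows "((\<lambda>x. if c then F x else G x) has_real_derivative (if c then F' else G')) (at x)"
  using assms by auto

lemma derivatives_eq_on_open:
  fixes F G :: "real \<Rightarrow> real"
  assumes "open I" "r \<in> I" "\<And>s. s \<in> I \<Longrightarrow> F s = G s"
    and "(F has_real_derivative F') (at r)" "(G has_real_derivative G') (at r)"
  shows "F' = G'"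
  using has_field_derivative_transform_within_open[OF assms(4,1,2,3)] assms(5)
  by (rule DERIV_unique)

lemma constant_of_zero_derivative:
  fixes F :: "real \<Rightarrow> real"
  assumes "is_interval I" "\<And>r. r \<in> I \<Longrightarrow> (F has_real_derivative 0) (at r)"
  obtains c where "\<And>r. r \<in> I \<Longrightarrow> F r = c"
  using has_field_derivative_zero_constant[of I F] assms
  by (metis has_field_derivative_at_within is_interval_convex)

section \<open>The scaling invariant system\<close>

text \<open>
  In the variable \<open>log r\<close> both differential equations are autonomous, and the algebraic relation
  involves \<open>r\<close> only through its left hand side. Combined with its derivative, it eliminates \<open>r\<close>; the
  result is linear in \<open>f\<close>, namely \<open>f G(y) = 2 y - \<kappa> / 2\<close> with the polynomial \<open>G\<close> below. The
  derivative of this equation, multiplied by \<open>G(y)\<close>, eliminates \<open>f\<close> and gives \<open>P(y) = 0\<close>.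
\<close>

lemma no_scaling_solution:
  fixes y f :: "real \<Rightarrow> real" and \<kappa> C :: real
  defines "D \<equiv> [:\<kappa> / 2, -5, -1:]"
    and "N \<equiv> [:2 - \<kappa> / 4, 5, 1:]"
  assumes I: "open I" "is_interval I" "I \<noteq> {}" "I \<subseteq> {0<..}"
    and "\<kappa> \<noteq> 0" "C \<noteq> 0"
    and f_pos: "\<And>r. r \<in> I \<Longrightarrow> f r > 0"
    and y': "\<And>r. r \<in> I \<Longrightarrow> (y has_real_derivative poly D (y r) / r) (at r)"
    and f': "\<And>r. r \<in> I \<Longrightarrow> (f has_real_derivative - (2 + y r) * f r / r) (at r)"
    and algebraic: "\<And>r. r \<in> I \<Longrightarrow> C * r * y r = - \<kappa> * f r * (poly N (y r) * f r + 1)"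
  shows False
proof -
  have r_pos: "r > 0" if "r \<in> I" for r
    using that I(4) by auto
  define G where "G = N * [:\<kappa> / 2, 0, 1:] - [:0, 5, 2:] * D"
  define P where "P = [:- \<kappa> / 2, 2:] * (pderiv G * D - [:2, 1:] * G) - [:2:] * (D * G)"
  have alg': "C * r * (y r + poly D (y r)) =
      \<kappa> * f r * ((2 + y r) * (2 * poly N (y r) * f r + 1) - f r * (2 * y r + 5) * poly D (y r))"
    if r: "r \<in> I" for r
  proof -
    define X where "X = C * y r + C * r * (poly D (y r) / r)"
    define Y where "Y = - \<kappa> * (- (2 + y r) * f r / r) * (poly N (y r) * f r + 1)
       - \<kappa> * f r * (poly (pderiv N) (y r) * (poly D (y r) / r) * f r
           + poly N (y r) * (- (2 + y r) * f r / r))"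
    have "X = Y"
    proof (rule derivatives_eq_on_open[OF I(1) r algebraic])
      show "((\<lambda>r. C * r * y r) has_real_derivative X) (at r)"
        unfolding X_def by (rule derivative_eq_intros y'[OF r] refl)+ simp
      show "((\<lambda>r. - \<kappa> * f r * (poly N (y r) * f r + 1)) has_real_derivative Y) (at r)"
        unfolding Y_def by (rule derivative_eq_intros f'[OF r] y'[OF r] refl)+
          (use r_pos[OF r] in \<open>simp add: field_simps\<close>)
    qed
    moreover have "r * X = C * r * (y r + poly D (y r))"
      using r_pos[OF r] by (simp add: X_def field_simps)
    moreover have "poly (pderiv N) (y r) = 2 * y r + 5"
      by (simp add: N_def pderiv_pCons)
    then have "r * Y = \<kappa> * f r * ((2 + y r) * (2 * poly N (y r) * f r + 1)
        - f r * (2 * y r + 5) * poly D (y r))"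
      using r_pos[OF r] by (simp add: Y_def field_simps)
    ultimately show ?thesis
      by simp
  qed
  have fG: "f r * poly G (y r) = 2 * y r - \<kappa> / 2" if r: "r \<in> I" for r
  proof -
    have "\<kappa> * f r * (f r * poly G (y r) - (2 * y r - \<kappa> / 2)) =
      y r * (C * r * (y r + poly D (y r)))
      - (C * r * y r) * (y r + poly D (y r))"
      unfolding alg'[OF r] algebraic[OF r]
      by (simp add: G_def D_def N_def field_simps)
    then show ?thesis
      using \<open>\<kappa> \<noteq> 0\<close> f_pos[OF r] by simp
  qed
  have P: "poly P (y r) = 0" if r: "r \<in> I" for r
  proof -
    have "- (2 + y r) * f r / r * poly G (y r)
        + f r * (poly (pderiv G) (y r) * (poly D (y r) / r)) = 2 * (poly D (y r) / r)"
    proof (rule derivatives_eq_on_open[OF I(1) r fG])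
      show "((\<lambda>r. f r * poly G (y r)) has_real_derivative
         - (2 + y r) * f r / r * poly G (y r)
         + f r * (poly (pderiv G) (y r) * (poly D (y r) / r))) (at r)"
        by (rule derivative_eq_intros f'[OF r] y'[OF r] refl)+
         (use r_pos[OF r] in \<open>simp add: field_simps\<close>)
      show "((\<lambda>r. 2 * y r - \<kappa> / 2) has_real_derivative 2 * (poly D (y r) / r)) (at r)"
        by (rule derivative_eq_intros y'[OF r] refl)+ simp
    qed
    then have "- (2 + y r) * (f r * poly G (y r))
        + f r * (poly (pderiv G) (y r) * poly D (y r)) = 2 * poly D (y r)"
      using r_pos[OF r] by (simp add: field_simps)
    then have "f r * (poly (pderiv G) (y r) * poly D (y r) - (2 + y r) * poly G (y r))
        * poly G (y r) = 2 * poly D (y r) * poly G (y r)"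
      by (simp add: algebra_simps)
    then have "(f r * poly G (y r)) *
        (poly (pderiv G) (y r) * poly D (y r) - (2 + y r) * poly G (y r))
        = 2 * poly D (y r) * poly G (y r)"
      by (simp add: algebra_simps)
    then show ?thesis
      unfolding fG[OF r] by (simp add: P_def algebra_simps)
  qed
  \<comment> \<open>The leading coefficient does not depend on \<open>\<kappa>\<close>, hence \<open>P\<close> is nonzero for all parameters.\<close>
  have "coeff P 6 = -24"
    by (simp add: P_def G_def D_def N_def pderiv_pCons numeral_eq_Suc)
  then have "P \<noteq> 0"
    by auto
  then have "finite (y ` I)"
    by (rule finite_subset[rotated, OF poly_roots_finite]) (use P in auto)
  moreover have "continuous_on I y"
    by (intro continuous_at_imp_continuous_on ballI DERIV_isCont[OF y'])
  ultimately have "y constant_on I"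
    using continuous_finite_range_constant[of I y] is_interval_connected[OF I(2)] by blast
  then obtain z where z: "y r = z" if "r \<in> I" for r
    unfolding constant_on_def by blast
  obtain r where r: "r \<in> I"
    using I(3) by blast
  have "poly D z / r = 0"
    by (rule derivatives_eq_on_open[OF I(1) r, of y "\<lambda>_. z"])
      (use y'[OF r] z r in auto)
  then have D0: "poly D z = 0"
    using r_pos[OF r] by simp
  then have k: "\<kappa> = 10 * z + 2 * z\<^sup>2"
    by (simp add: D_def power2_eq_square algebra_simps)
  \<comment> \<open>For constant \<open>y = z\<close>, the equation \<open>f G(z) = 2 z - \<kappa> / 2\<close> has zero derivative,
    so \<open>z = -2\<close> or its right hand side \<open>- z (z + 3)\<close> vanishes.\<close>
  have "z * (z + 3) * (z + 2) = 0"
  proof -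
    have "- (2 + z) * f r / r * poly G z = 0"
      by (rule derivatives_eq_on_open[OF I(1) r, of "\<lambda>r. f r * poly G z" "\<lambda>_. 2 * z - \<kappa> / 2"])
        (use f'[OF r] z fG r in \<open>auto intro!: derivative_eq_intros\<close>)
    then have "(2 + z) * (f r * poly G z) = 0"
      using r_pos[OF r] by auto
    then show ?thesis
      using fG[OF r] unfolding z[OF r] k by (simp add: power2_eq_square algebra_simps)
  qed
  moreover have "z \<noteq> 0"
    using k \<open>\<kappa> \<noteq> 0\<close> by auto
  moreover have "z \<noteq> -3"
  proof
    assume [simp]: "z = -3"
    have "\<kappa> = -12"
      using k by simp
    then have "poly G (-3) = -3" "2 * z - \<kappa> / 2 = 0"
      by (simp_all add: G_def N_def D_def)
    then show False
      using fG[OF r] f_pos[OF r] z[OF r] by simp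
  qed
  moreover have "z \<noteq> -2"
  proof
    assume "z = -2"
    then have "C * r * (-2) = 0"
      using alg'[OF r] unfolding z[OF r] D0 by simp
    then show False
      using r_pos[OF r] \<open>C \<noteq> 0\<close> by simp
  qed
  ultimately show False by (auto simp: eq_neg_iff_add_eq_0)
qed

section \<open>The metric and its curvature\<close>

text \<open>
  The metric \<open>- f dt\<^sup>2 + f\<^sup>-\<^sup>1 dr\<^sup>2 + r\<^sup>2 d\<Omega>\<^sup>2\<close>. Four derivatives of \<open>f\<close> are named
  because \<open>A\<close> is of fourth order in the metric. The metric \<open>g\<close> is only assumed to have this form
  on the chart.
\<close>

locale schwarzschild_profile =
  fixes I :: "real set" and f f1 f2 f3 f4 :: "real \<Rightarrow> real" and g :: "4 metric"
  assumes open_I: "open I" and interval_I: "is_interval I" and I_nonempty: "I \<noteq> {}"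
    and I_pos: "I \<subseteq> {0<..}"
    and f_pos: "r \<in> I \<Longrightarrow> f r > 0"
    and f': "r \<in> I \<Longrightarrow> (f has_real_derivative f1 r) (at r)"
    and f'': "r \<in> I \<Longrightarrow> (f1 has_real_derivative f2 r) (at r)"
    and f''': "r \<in> I \<Longrightarrow> (f2 has_real_derivative f3 r) (at r)"
    and f'''': "r \<in> I \<Longrightarrow> (f3 has_real_derivative f4 r) (at r)"
    and metric: "x \<in> sph_chart I \<Longrightarrow> g x = sph_metric f (\<lambda>r. 1 / f r) x"
begin

lemma r_pos: "r \<in> I \<Longrightarrow> r > 0"
  using I_pos by auto

lemma chartD:
  assumes "x \<in> sph_chart I"
  shows "x $ 2 \<in> I" "sin (x $ 3) > 0" "f (x $ 2) > 0" "x $ 2 > 0"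
  using assms by (auto simp: sph_chart_def f_pos r_pos intro!: sin_gt_zero)

text \<open>
  The diagonal entries of the metric are written as products of a radial factor and an angular
  factor, with a table of derivatives for each.
\<close>

definition g_rad :: "4 \<Rightarrow> real \<Rightarrow> real" where
  "g_rad i r = (if i = 1 then - f r else if i = 2 then 1 / f r else r\<^sup>2)"
definition dg_rad :: "4 \<Rightarrow> real \<Rightarrow> real" where
  "dg_rad i r = (if i = 1 then - f1 r else if i = 2 then - f1 r / (f r)\<^sup>2 else 2 * r)"
definition g_ang :: "4 \<Rightarrow> real \<Rightarrow> real" where
  "g_ang i \<theta> = (if i = 4 then (sin \<theta>)\<^sup>2 else 1)"
definition dg_ang :: "4 \<Rightarrow> real \<Rightarrow> real" where
  "dg_ang i \<theta> = (if i = 4 then 2 * sin \<theta> * cos \<theta> else 0)"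

lemma g_rad_derivative: "r \<in> I \<Longrightarrow> (g_rad i has_real_derivative dg_rad i r) (at r)"
  unfolding g_rad_def[abs_def] dg_rad_def using f_pos[of r]
  by (auto intro!: derivative_eq_intros f' simp: power2_eq_square)

lemma g_ang_derivative: "(g_ang i has_real_derivative dg_ang i \<theta>) (at \<theta>)"
  unfolding g_ang_def[abs_def] dg_ang_def by (auto intro!: derivative_eq_intros)

lemma metric_component:
  "x \<in> sph_chart I \<Longrightarrow> g x $ i $ j = (if i = j then g_rad i (x $ 2) * g_ang i (x $ 3) else 0)"
  using exhaust_4[of i] by (auto simp: metric sph_metric_def g_rad_def g_ang_def)

lemma g_rad_ang_nonzero: "x \<in> sph_chart I \<Longrightarrow> g_rad i (x $ 2) * g_ang i (x $ 3) \<noteq> 0"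
  using chartD[of x] by (auto simp: g_rad_def g_ang_def)

lemma ginv_component:
  "x \<in> sph_chart I \<Longrightarrow> ginv g i j x = (if i = j then 1 / (g_rad i (x $ 2) * g_ang i (x $ 3)) else 0)"
  by (rule ginv_diagonal[where d = "\<lambda>i. g_rad i (x $ 2) * g_ang i (x $ 3)"])
    (simp_all only: metric_component g_rad_ang_nonzero not_False_eq_True simp_thms)

lemma pd_metric:
  assumes "x \<in> sph_chart I"
  shows "pd k (\<lambda>y. g y $ i $ j) x = (if i \<noteq> j then 0
    else if k = 2 then dg_rad i (x $ 2) * g_ang i (x $ 3)
    else if k = 3 then g_rad i (x $ 2) * dg_ang i (x $ 3) else 0)"
proof (cases "i = j")
  case True
  have "pd k (\<lambda>y. g y $ i $ j) x = (if k = 2 then dg_rad i (x $ 2) * g_ang i (x $ 3)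
      else if k = 3 then g_rad i (x $ 2) * dg_ang i (x $ 3) else 0)"
    by (rule pd_separated[OF open_I assms _ g_rad_derivative g_ang_derivative])
      (simp_all add: metric_component True chartD[OF assms])
  then show ?thesis
    using True by simp
next
  case False
  have "pd k (\<lambda>y. g y $ i $ j) x = (if k = 2 then 0 * 0 else if k = 3 then 0 * 0 else 0)"
    by (rule pd_separated[OF open_I assms _ DERIV_const DERIV_const])
      (simp add: metric_component False)
  then show ?thesis
    using False by simp
qed

text \<open>
  Christoffel symbols are tabulated in the same way. The upper index comes first, as in
  \<^const>\<open>christoffel\<close>. Where the symbol vanishes, the radial factor is 0 and the angular factor 1.
\<close>

definition \<Gamma>_rad :: "4 \<Rightarrow> 4 \<Rightarrow> 4 \<Rightarrow> real \<Rightarrow> real" where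
  "\<Gamma>_rad k i j r =
    (if k = 1 \<and> (i = 1 \<and> j = 2 \<or> i = 2 \<and> j = 1) then f1 r / (2 * f r)
     else if k = 2 \<and> i = 1 \<and> j = 1 then f r * f1 r / 2
     else if k = 2 \<and> i = 2 \<and> j = 2 then - f1 r / (2 * f r)
     else if k = 2 \<and> (i = 3 \<or> i = 4) \<and> j = i then - r * f r
     else if (k = 3 \<or> k = 4) \<and> (i = 2 \<and> j = k \<or> i = k \<and> j = 2) then 1 / r
     else if k = 3 \<and> i = 4 \<and> j = 4 \<or> k = 4 \<and> (i = 3 \<and> j = 4 \<or> i = 4 \<and> j = 3) then 1
     else 0)"
definition d\<Gamma>_rad :: "4 \<Rightarrow> 4 \<Rightarrow> 4 \<Rightarrow> real \<Rightarrow> real" where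
  "d\<Gamma>_rad k i j r =
    (if k = 1 \<and> (i = 1 \<and> j = 2 \<or> i = 2 \<and> j = 1) then (f2 r * f r - (f1 r)\<^sup>2) / (2 * (f r)\<^sup>2)
     else if k = 2 \<and> i = 1 \<and> j = 1 then ((f1 r)\<^sup>2 + f r * f2 r) / 2
     else if k = 2 \<and> i = 2 \<and> j = 2 then - (f2 r * f r - (f1 r)\<^sup>2) / (2 * (f r)\<^sup>2)
     else if k = 2 \<and> (i = 3 \<or> i = 4) \<and> j = i then - f r - r * f1 r
     else if (k = 3 \<or> k = 4) \<and> (i = 2 \<and> j = k \<or> i = k \<and> j = 2) then - 1 / r\<^sup>2
     else 0)"
definition \<Gamma>_ang :: "4 \<Rightarrow> 4 \<Rightarrow> 4 \<Rightarrow> real \<Rightarrow> real" where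
  "\<Gamma>_ang k i j \<theta> =
    (if k = 2 \<and> i = 4 \<and> j = 4 then (sin \<theta>)\<^sup>2
     else if k = 3 \<and> i = 4 \<and> j = 4 then - sin \<theta> * cos \<theta>
     else if k = 4 \<and> (i = 3 \<and> j = 4 \<or> i = 4 \<and> j = 3) then cos \<theta> / sin \<theta>
     else 1)"
definition d\<Gamma>_ang :: "4 \<Rightarrow> 4 \<Rightarrow> 4 \<Rightarrow> real \<Rightarrow> real" where
  "d\<Gamma>_ang k i j \<theta> =
    (if k = 2 \<and> i = 4 \<and> j = 4 then 2 * sin \<theta> * cos \<theta>
     else if k = 3 \<and> i = 4 \<and> j = 4 then (sin \<theta>)\<^sup>2 - (cos \<theta>)\<^sup>2
     else if k = 4 \<and> (i = 3 \<and> j = 4 \<or> i = 4 \<and> j = 3) then - 1 / (sin \<theta>)\<^sup>2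
     else 0)"

lemma \<Gamma>_rad_derivative:
  assumes r: "r \<in> I"
  shows "(\<Gamma>_rad k i j has_real_derivative d\<Gamma>_rad k i j r) (at r)"
proof -
  have "f r \<noteq> 0" "r \<noteq> 0"
    using f_pos[OF r] r_pos[OF r] by auto
  then have
    "((\<lambda>r. f1 r / (2 * f r)) has_real_derivative (f2 r * f r - (f1 r)\<^sup>2) / (2 * (f r)\<^sup>2)) (at r)"
    "((\<lambda>r. - f1 r / (2 * f r)) has_real_derivative - (f2 r * f r - (f1 r)\<^sup>2) / (2 * (f r)\<^sup>2)) (at r)"
    "((\<lambda>r. f r * f1 r / 2) has_real_derivative ((f1 r)\<^sup>2 + f r * f2 r) / 2) (at r)"
    "((\<lambda>r. - r * f r) has_real_derivative - f r - r * f1 r) (at r)"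
    "((\<lambda>r. 1 / r) has_real_derivative - 1 / r\<^sup>2) (at r)"
    by (auto intro!: derivative_eq_intros f'[OF r] f''[OF r] simp: field_simps power2_eq_square)
  then show ?thesis
    unfolding \<Gamma>_rad_def[abs_def] d\<Gamma>_rad_def by (intro DERIV_if DERIV_const)
qed

lemma \<Gamma>_ang_derivative:
  assumes "sin \<theta> > 0"
  shows "(\<Gamma>_ang k i j has_real_derivative d\<Gamma>_ang k i j \<theta>) (at \<theta>)"
proof -
  have "((\<lambda>\<theta>. (sin \<theta>)\<^sup>2) has_real_derivative 2 * sin \<theta> * cos \<theta>) (at \<theta>)"
    "((\<lambda>\<theta>. - sin \<theta> * cos \<theta>) has_real_derivative (sin \<theta>)\<^sup>2 - (cos \<theta>)\<^sup>2) (at \<theta>)"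
    by (auto intro!: derivative_eq_intros simp: power2_eq_square)
  moreover have "((\<lambda>\<theta>. cos \<theta> / sin \<theta>) has_real_derivative - 1 / (sin \<theta>)\<^sup>2) (at \<theta>)"
  proof -
    have "((\<lambda>\<theta>. cos \<theta> / sin \<theta>) has_real_derivative
        (- sin \<theta> * sin \<theta> - cos \<theta> * cos \<theta>) / (sin \<theta> * sin \<theta>)) (at \<theta>)"
      by (rule DERIV_divide) (use assms in \<open>auto intro!: derivative_eq_intros\<close>)
    moreover have "- sin \<theta> * sin \<theta> - cos \<theta> * cos \<theta> = - 1"
      using sin_cos_squared_add3[of \<theta>] by linarith
    ultimately show ?thesis
      by (simp add: power2_eq_square)
  qed
  ultimately show ?thesis
    unfolding \<Gamma>_ang_def[abs_def] d\<Gamma>_ang_def by (intro DERIV_if DERIV_const)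
qed

lemma christoffel_component:
  assumes x: "x \<in> sph_chart I"
  shows "christoffel g k i j x = \<Gamma>_rad k i j (x $ 2) * \<Gamma>_ang k i j (x $ 3)"
proof -
  have diagonal: "christoffel g k i j x =
    (pd i (\<lambda>y. g y $ j $ k) x + pd j (\<lambda>y. g y $ i $ k) x - pd k (\<lambda>y. g y $ i $ j) x)
      / (2 * (g_rad k (x $ 2) * g_ang k (x $ 3)))" for k i j
    by (simp add: christoffel_def ginv_component[OF x] if_distrib[of "\<lambda>c. c * _"] cong: if_cong)
  have "\<forall>k i j. christoffel g k i j x = \<Gamma>_rad k i j (x $ 2) * \<Gamma>_ang k i j (x $ 3)"
    using chartD[OF x] unfolding forall_4 diagonal pd_metric[OF x]
    by (simp add: \<Gamma>_rad_def \<Gamma>_ang_def g_rad_def g_ang_def dg_rad_def dg_ang_def power2_eq_square)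
  then show ?thesis by blast
qed

lemma pd_christoffel:
  assumes "x \<in> sph_chart I"
  shows "pd d (christoffel g k i j) x = (if d = 2 then d\<Gamma>_rad k i j (x $ 2) * \<Gamma>_ang k i j (x $ 3)
    else if d = 3 then \<Gamma>_rad k i j (x $ 2) * d\<Gamma>_ang k i j (x $ 3) else 0)"
  by (rule pd_separated[OF open_I assms christoffel_component \<Gamma>_rad_derivative \<Gamma>_ang_derivative])
    (simp_all add: chartD[OF assms])

text \<open>
  The sectional curvature of the plane spanned by two coordinate directions.
\<close>

definition sec :: "4 \<Rightarrow> 4 \<Rightarrow> real \<Rightarrow> real" where
  "sec k i r = (if k = i then 0
     else if {k, i} = {1, 2} then - f2 r / 2
     else if {k, i} = {3, 4} then (1 - f r) / r\<^sup>2
     else - f1 r / (2 * r))"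

text \<open>
  Only components of the form \<open>Riem\<^sup>k\<^sub>i\<^sub>k\<^sub>j\<close> are computed: the Ricci tensor is a sum of these, and
  \<open>Ric \<cdot> Riem\<close> needs no others because the Ricci tensor is diagonal.
\<close>

lemma riem_component:
  assumes x: "x \<in> sph_chart I"
  shows "riem g k i k j x = (if i = j then sec k i (x $ 2) * (g_rad i (x $ 2) * g_ang i (x $ 3)) else 0)"
proof -
  have cos2: "cos (x $ 3) * cos (x $ 3) = 1 - sin (x $ 3) * sin (x $ 3)"
    using cos_squared_eq[of "x $ 3"] by (simp add: power2_eq_square)
  have cos2': "cos (x $ 3) * (cos (x $ 3) * c) = c - sin (x $ 3) * (sin (x $ 3) * c)" for c
    unfolding mult.assoc[symmetric] cos2 by (simp add: algebra_simps)
  have "\<forall>k i j. riem g k i k j x = (if i = j then sec k i (x $ 2) * (g_rad i (x $ 2) * g_ang i (x $ 3)) else 0)"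
    using chartD[OF x]
    unfolding forall_4 riem_christoffel christoffel_component[OF x] pd_christoffel[OF x] sum_4
    by (simp add: \<Gamma>_rad_def \<Gamma>_ang_def d\<Gamma>_rad_def d\<Gamma>_ang_def g_rad_def g_ang_def sec_def doubleton_eq_iff)
      (simp add: field_simps power2_eq_square cos2 cos2')
  then show ?thesis by blast
qed

text \<open>
  The eigenvalues of the Ricci tensor on the \<open>(t, r)\<close>-plane and on the spheres, with their
  first two derivatives. The form of \<open>dq\<close> is the contracted Bianchi identity.
\<close>

definition p :: "real \<Rightarrow> real" where "p r = - (f2 r / 2 + f1 r / r)"
definition dp :: "real \<Rightarrow> real" where "dp r = - (f3 r / 2 + f2 r / r - f1 r / r\<^sup>2)"
definition ddp :: "real \<Rightarrow> real" where
  "ddp r = - (f4 r / 2 + f3 r / r - 2 * f2 r / r\<^sup>2 + 2 * f1 r / r ^ 3)"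
definition q :: "real \<Rightarrow> real" where "q r = (1 - f r - r * f1 r) / r\<^sup>2"
definition dq :: "real \<Rightarrow> real" where "dq r = 2 * (p r - q r) / r"
definition ddq :: "real \<Rightarrow> real" where "ddq r = 2 * (dp r - dq r) / r - 2 * (p r - q r) / r\<^sup>2"

lemma p_derivatives:
  assumes "r \<in> I"
  shows "(p has_real_derivative dp r) (at r)" "(dp has_real_derivative ddp r) (at r)"
proof -
  have r: "r > 0" "r \<noteq> 0" "r\<^sup>2 \<noteq> 0"
    using r_pos[OF assms] by auto
  note d = derivative_eq_intros f'[OF assms] f''[OF assms] f'''[OF assms] f''''[OF assms] r(2,3)
    numeral_neq_zero refl
  show "(p has_real_derivative dp r) (at r)"
    unfolding p_def[abs_def] dp_def
    by (rule d)+ (use r in \<open>simp add: field_simps power2_eq_square\<close>)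
  show "(dp has_real_derivative ddp r) (at r)"
    unfolding dp_def[abs_def] ddp_def
    by (rule d)+ (use r in \<open>simp add: field_simps power2_eq_square power3_eq_cube\<close>)
qed

lemma q_derivatives:
  assumes "r \<in> I"
  shows "(q has_real_derivative dq r) (at r)" "(dq has_real_derivative ddq r) (at r)"
proof -
  have r: "r > 0" "r \<noteq> 0" "r\<^sup>2 \<noteq> 0"
    using r_pos[OF assms] by auto
  show dq: "(q has_real_derivative dq r) (at r)"
    unfolding q_def[abs_def] dq_def p_def
    by (rule derivative_eq_intros f'[OF assms] f''[OF assms] r(2,3) numeral_neq_zero refl)+
      (use r in \<open>simp add: field_simps power2_eq_square\<close>)
  show "(dq has_real_derivative ddq r) (at r)"
    unfolding dq_def[abs_def] ddq_def
    by (rule derivative_eq_intros p_derivatives[OF assms] dq[unfolded dq_def] r(2,3) numeral_neq_zero refl)+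
      (use r in \<open>simp add: field_simps power2_eq_square\<close>)
qed

text \<open>
  The eigenvalue that belongs to a given coordinate direction.
\<close>

definition \<rho> :: "4 \<Rightarrow> real \<Rightarrow> real" where "\<rho> i r = (if i = 1 \<or> i = 2 then p r else q r)"
definition d\<rho> :: "4 \<Rightarrow> real \<Rightarrow> real" where "d\<rho> i r = (if i = 1 \<or> i = 2 then dp r else dq r)"
definition dd\<rho> :: "4 \<Rightarrow> real \<Rightarrow> real" where "dd\<rho> i r = (if i = 1 \<or> i = 2 then ddp r else ddq r)"

lemma \<rho>_derivatives: "r \<in> I \<Longrightarrow> (\<rho> i has_real_derivative d\<rho> i r) (at r)"
  "r \<in> I \<Longrightarrow> (d\<rho> i has_real_derivative dd\<rho> i r) (at r)"
  unfolding \<rho>_def[abs_def] d\<rho>_def[abs_def] dd\<rho>_def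
  by (auto simp: p_derivatives q_derivatives)

lemma sum_sec:
  "r \<in> I \<Longrightarrow> (\<Sum>k\<in>UNIV. sec k i r) = \<rho> i r"
  using exhaust_4[of i] r_pos[of r]
  by (auto simp: sum_4 sec_def \<rho>_def p_def q_def doubleton_eq_iff field_simps power2_eq_square)

lemma ric_component:
  assumes x: "x \<in> sph_chart I"
  shows "ric g i j x = (if i = j then \<rho> i (x $ 2) * g_rad i (x $ 2) * g_ang i (x $ 3) else 0)"
proof -
  have "ric g i j x = (\<Sum>k\<in>UNIV. if i = j then sec k i (x $ 2) * (g_rad i (x $ 2) * g_ang i (x $ 3)) else 0)"
    by (simp add: ric_def riem_component[OF x])
  also have "\<dots> = (if i = j then (\<Sum>k\<in>UNIV. sec k i (x $ 2)) * (g_rad i (x $ 2) * g_ang i (x $ 3)) else 0)"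
    by (simp add: sum_distrib_right)
  finally show ?thesis
    by (simp add: sum_sec chartD[OF x] mult.assoc)
qed

lemma ric_mixed_component:
  assumes x: "x \<in> sph_chart I"
  shows "ric_mixed g i j x = (if i = j then \<rho> i (x $ 2) else 0)"
  using g_rad_ang_nonzero[OF x, of i] g_rad_ang_nonzero[OF x, of j]
  by (simp add: ric_mixed_def ginv_component[OF x] ric_component[OF x]
      if_distrib[of "\<lambda>c. c * _"] cong: if_cong)

lemma ric_riem_component:
  assumes x: "x \<in> sph_chart I"
  shows "ric_riem g i i x = (\<Sum>k\<in>UNIV. sec k i (x $ 2) * \<rho> k (x $ 2)) * (g_rad i (x $ 2) * g_ang i (x $ 3))"
proof -
  have "ric_riem g i i x = (\<Sum>k\<in>UNIV. \<Sum>l\<in>UNIV. if l = k then riem g k i k i x * \<rho> k (x $ 2) else 0)"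
    unfolding ric_riem_def ric_mixed_component[OF x] by (intro sum.cong) auto
  also have "\<dots> = (\<Sum>k\<in>UNIV. riem g k i k i x * \<rho> k (x $ 2))"
    by simp
  finally show ?thesis
    by (simp add: riem_component[OF x] sum_distrib_left ac_simps)
qed

lemma scal_eq:
  assumes x: "x \<in> sph_chart I"
  shows "scal g x = 2 * p (x $ 2) + 2 * q (x $ 2)"
proof -
  have "scal g x = (\<Sum>i\<in>UNIV. \<Sum>j\<in>UNIV. if j = i then \<rho> i (x $ 2) else 0)"
    unfolding scal_def
  proof (intro sum.cong refl)
    fix i j
    show "ginv g i j x * ric g i j x = (if j = i then \<rho> i (x $ 2) else 0)"
      using g_rad_ang_nonzero[OF x, of i] by (auto simp: ginv_component[OF x] ric_component[OF x])
  qed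
  then show ?thesis
    by (simp add: sum_4 \<rho>_def)
qed

lemma ric_norm2_eq:
  assumes x: "x \<in> sph_chart I"
  shows "ric_norm2 g x = 2 * (p (x $ 2))\<^sup>2 + 2 * (q (x $ 2))\<^sup>2"
proof -
  have "ric_norm2 g x = (\<Sum>i\<in>UNIV. (\<rho> i (x $ 2))\<^sup>2)"
    unfolding ric_norm2_def
  proof (rule sum.cong[OF refl])
    fix i
    have "(\<Sum>j\<in>UNIV. \<Sum>k\<in>UNIV. \<Sum>l\<in>UNIV. ginv g i k x * ginv g j l x * ric g i j x * ric g k l x)
      = (\<Sum>j\<in>UNIV. \<Sum>k\<in>UNIV. \<Sum>l\<in>UNIV.
           if l = j then if k = i then if j = i then (\<rho> i (x $ 2))\<^sup>2 else 0 else 0 else 0)"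
      using g_rad_ang_nonzero[OF x, of i]
      by (intro sum.cong refl)
        (auto simp: ginv_component[OF x] ric_component[OF x] power2_eq_square)
    then show "(\<Sum>j\<in>UNIV. \<Sum>k\<in>UNIV. \<Sum>l\<in>UNIV. ginv g i k x * ginv g j l x * ric g i j x * ric g k l x)
      = (\<rho> i (x $ 2))\<^sup>2"
      by simp
  qed
  then show ?thesis
    by (simp add: sum_4 \<rho>_def)
qed

section \<open>The Laplacians of the Ricci tensor and of the scalar curvature\<close>

text \<open>
  Since the metric is parallel, \<open>\<nabla>\<^sub>r\<close> just differentiates the eigenvalues, and
  the angular derivatives are produced by the rotation of the \<open>r\<close>-direction against the sphere.
  They are therefore proportional to the difference \<open>p - q\<close>; no such term occurs within the
  \<open>(t, r)\<close>-plane, where the eigenvalues agree.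
\<close>

definition covRic_rad :: "4 \<Rightarrow> 4 \<Rightarrow> 4 \<Rightarrow> real \<Rightarrow> real" where
  "covRic_rad k i j r =
    (if k = 2 \<and> i = j then d\<rho> i r * g_rad i r
     else if (k = 3 \<or> k = 4) \<and> (i = 2 \<and> j = k \<or> i = k \<and> j = 2) then r * (p r - q r)
     else 0)"
definition dcovRic_rad :: "4 \<Rightarrow> 4 \<Rightarrow> 4 \<Rightarrow> real \<Rightarrow> real" where
  "dcovRic_rad k i j r =
    (if k = 2 \<and> i = j then dd\<rho> i r * g_rad i r + d\<rho> i r * dg_rad i r
     else if (k = 3 \<or> k = 4) \<and> (i = 2 \<and> j = k \<or> i = k \<and> j = 2)
     then p r - q r + r * (dp r - dq r)
     else 0)"
definition covRic_ang :: "4 \<Rightarrow> 4 \<Rightarrow> real \<Rightarrow> real" where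
  "covRic_ang i j \<theta> = (if i = 4 then g_ang i \<theta> else g_ang j \<theta>)"
definition dcovRic_ang :: "4 \<Rightarrow> 4 \<Rightarrow> real \<Rightarrow> real" where
  "dcovRic_ang i j \<theta> = (if i = 4 then dg_ang i \<theta> else dg_ang j \<theta>)"

lemma covRic_rad_derivative:
  assumes r: "r \<in> I"
  shows "(covRic_rad k i j has_real_derivative dcovRic_rad k i j r) (at r)"
proof -
  have "((\<lambda>r. d\<rho> i r * g_rad i r) has_real_derivative dd\<rho> i r * g_rad i r + d\<rho> i r * dg_rad i r) (at r)"
    using DERIV_mult[OF \<rho>_derivatives(2)[OF r] g_rad_derivative[OF r], of i i] by (simp add: ac_simps)
  moreover have "((\<lambda>r. r * (p r - q r)) has_real_derivative p r - q r + r * (dp r - dq r)) (at r)"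
    by (rule derivative_eq_intros p_derivatives[OF r] q_derivatives[OF r] refl)+ simp
  ultimately show ?thesis
    unfolding covRic_rad_def[abs_def] dcovRic_rad_def by (intro DERIV_if DERIV_const)
qed

lemma covRic_ang_derivative: "(covRic_ang i j has_real_derivative dcovRic_ang i j \<theta>) (at \<theta>)"
  unfolding covRic_ang_def[abs_def] dcovRic_ang_def by (intro DERIV_if g_ang_derivative)

lemma pd_ric:
  assumes x: "x \<in> sph_chart I"
  shows "pd k (ric g i j) x = (if i \<noteq> j then 0
    else if k = 2 then (d\<rho> i (x $ 2) * g_rad i (x $ 2) + \<rho> i (x $ 2) * dg_rad i (x $ 2)) * g_ang i (x $ 3)
    else if k = 3 then \<rho> i (x $ 2) * g_rad i (x $ 2) * dg_ang i (x $ 3) else 0)"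
proof (cases "i = j")
  case True
  have D: "((\<lambda>r. \<rho> i r * g_rad i r) has_real_derivative
      d\<rho> i (x $ 2) * g_rad i (x $ 2) + \<rho> i (x $ 2) * dg_rad i (x $ 2)) (at (x $ 2))"
    using DERIV_mult[OF \<rho>_derivatives(1) g_rad_derivative, of "x $ 2" i i] chartD[OF x]
      by (simp add: ac_simps)
  have "pd k (ric g i j) x = (if k = 2
      then (d\<rho> i (x $ 2) * g_rad i (x $ 2) + \<rho> i (x $ 2) * dg_rad i (x $ 2)) * g_ang i (x $ 3)
      else if k = 3 then \<rho> i (x $ 2) * g_rad i (x $ 2) * dg_ang i (x $ 3) else 0)"
    by (rule pd_separated[OF open_I x _ D g_ang_derivative]) (simp add: ric_component True)
  then show ?thesis
    using True by simp
next
  case False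
  have "pd k (ric g i j) x = (if k = 2 then 0 * 0 else if k = 3 then 0 * 0 else 0)"
    by (rule pd_separated[OF open_I x _ DERIV_const DERIV_const])
      (simp add: ric_component False)
  then show ?thesis
    using False by simp
qed

lemma cov_ric_component:
  assumes x: "x \<in> sph_chart I"
  shows "cov2 g (ric g) k i j x = covRic_rad k i j (x $ 2) * covRic_ang i j (x $ 3)"
proof -
  have "\<forall>k i j. cov2 g (ric g) k i j x = covRic_rad k i j (x $ 2) * covRic_ang i j (x $ 3)"
    using chartD[OF x]
    unfolding forall_4 cov2_def christoffel_component[OF x] pd_ric[OF x] ric_component[OF x] sum_4
    by (simp add: \<Gamma>_rad_def \<Gamma>_ang_def g_rad_def g_ang_def dg_rad_def dg_ang_def covRic_rad_def covRic_ang_def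
      \<rho>_def d\<rho>_def)
      (simp add: field_simps power2_eq_square)
  then show ?thesis by blast
qed

lemma pd_cov_ric:
  assumes x: "x \<in> sph_chart I"
  shows "pd d (cov2 g (ric g) k i j) x = (if d = 2 then dcovRic_rad k i j (x $ 2) * covRic_ang i j (x $ 3)
    else if d = 3 then covRic_rad k i j (x $ 2) * dcovRic_ang i j (x $ 3) else 0)"
  by (rule pd_separated[OF open_I x cov_ric_component covRic_rad_derivative covRic_ang_derivative])
    (simp_all add: chartD[OF x])

text \<open>
  The operator \<open>\<box>\<close> on functions of \<open>r\<close>, applied to the first two derivatives of the function.
\<close>

definition scalar_box :: "(real \<Rightarrow> real) \<Rightarrow> (real \<Rightarrow> real) \<Rightarrow> real \<Rightarrow> real" where
  "scalar_box F1 F2 r = f r * F2 r + (f1 r + 2 * f r / r) * F1 r"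

text \<open>
  Besides \<open>\<box>\<close> of the eigenvalues there are zeroth order terms in \<open>p - q\<close>, for the reason given
  above. They are absent from the \<open>tt\<close> component and cancel in the trace. The
  \<open>\<phi>\<phi>\<close> component carries the same information as the \<open>\<theta>\<theta>\<close> component by symmetry.
\<close>

lemma box_ric:
  assumes x: "x \<in> sph_chart I"
  defines "r \<equiv> x $ 2"
  shows "box2 g (ric g) 1 1 x = - f r * scalar_box dp ddp r"
    "box2 g (ric g) 2 2 x = (scalar_box dp ddp r - 4 * f r * (p r - q r) / r\<^sup>2) / f r"
    "box2 g (ric g) 3 3 x = r\<^sup>2 * (scalar_box dq ddq r + 2 * f r * (p r - q r) / r\<^sup>2)"
proof -
  have diagonal: "box2 g (ric g) i j x =
     (\<Sum>k\<in>UNIV. cov3 g (cov2 g (ric g)) k k i j x / (g_rad k (x $ 2) * g_ang k (x $ 3)))" for i j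
    by (simp add: box2_def ginv_component[OF x] if_distrib[of "\<lambda>c. c * _"] cong: if_cong)
  note tables = \<Gamma>_rad_def \<Gamma>_ang_def g_rad_def g_ang_def dg_rad_def dg_ang_def covRic_rad_def dcovRic_rad_def
    covRic_ang_def dcovRic_ang_def d\<rho>_def dd\<rho>_def scalar_box_def
  note unf = diagonal cov3_def christoffel_component[OF x] pd_cov_ric[OF x] cov_ric_component[OF x] sum_4
  show "box2 g (ric g) 1 1 x = - f r * scalar_box dp ddp r"
    using chartD[OF x]
    unfolding unf r_def
    by (simp add: tables)
      (simp add: field_simps power2_eq_square)
  show "box2 g (ric g) 2 2 x = (scalar_box dp ddp r - 4 * f r * (p r - q r) / r\<^sup>2) / f r"
    using chartD[OF x]
    unfolding unf r_def
    by (simp add: tables)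
      (simp add: field_simps power2_eq_square)
  show "box2 g (ric g) 3 3 x = r\<^sup>2 * (scalar_box dq ddq r + 2 * f r * (p r - q r) / r\<^sup>2)"
    using chartD[OF x]
    unfolding unf r_def
    by (simp add: tables)
      (simp add: field_simps power2_eq_square)
qed

text \<open>
  The first two derivatives of the scalar curvature \<open>2 p + 2 q\<close>.
\<close>

definition dR :: "real \<Rightarrow> real" where "dR r = 2 * dp r + 2 * dq r"
definition ddR :: "real \<Rightarrow> real" where "ddR r = 2 * ddp r + 2 * ddq r"

lemma pd_scal:
  assumes x: "x \<in> sph_chart I"
  shows "pd i (scal g) x = (if i = 2 then dR (x $ 2) else 0)"
proof -
  have D: "((\<lambda>r. 2 * p r + 2 * q r) has_real_derivative dR (x $ 2)) (at (x $ 2))"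
    unfolding dR_def by (intro DERIV_add DERIV_cmult p_derivatives q_derivatives chartD[OF x])
  have "pd i (scal g) x = (if i = 2 then dR (x $ 2) * 1 else if i = 3
      then (2 * p (x $ 2) + 2 * q (x $ 2)) * 0 else 0)"
    by (rule pd_separated[OF open_I x _ D DERIV_const]) (simp add: scal_eq)
  then show ?thesis
    by simp
qed

lemma hess_scal:
  assumes x: "x \<in> sph_chart I"
  shows "hess g (scal g) i j x = (if i = 2 \<and> j = 2 then ddR (x $ 2) else 0)
    - \<Gamma>_rad 2 i j (x $ 2) * \<Gamma>_ang 2 i j (x $ 3) * dR (x $ 2)"
proof -
  have D: "((\<lambda>r. if j = 2 then dR r else 0) has_real_derivative (if j = 2 then ddR (x $ 2) else 0)) (at (x $ 2))"
    unfolding dR_def ddR_def by (intro DERIV_if DERIV_const DERIV_add DERIV_cmult p_derivatives q_derivatives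
      chartD[OF x])
  have "pd i (pd j (scal g)) x =
     (if i = 2 then (if j = 2 then ddR (x $ 2) else 0) * 1 else if i = 3
      then (if j = 2 then dR (x $ 2) else 0) * 0 else 0)"
    by (rule pd_separated[OF open_I x _ D DERIV_const]) (simp add: pd_scal)
  then show ?thesis
    by (simp add: hess_def cov1_def pd_scal[OF x] christoffel_component[OF x]
      if_distrib[of "\<lambda>c. _ * c"] cong: if_cong)
qed

lemma box_scal:
  assumes x: "x \<in> sph_chart I"
  shows "box0 g (scal g) x = scalar_box dR ddR (x $ 2)"
proof -
  have "box0 g (scal g) x = (\<Sum>i\<in>UNIV. hess g (scal g) i i x / (g_rad i (x $ 2) * g_ang i (x $ 3)))"
    by (simp add: box0_def ginv_component[OF x] if_distrib[of "\<lambda>c. c * _"] cong: if_cong)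
  also have "\<dots> = scalar_box dR ddR (x $ 2)"
    using chartD[OF x]
    by (simp add: hess_scal[OF x] sum_4 g_rad_def g_ang_def \<Gamma>_rad_def \<Gamma>_ang_def scalar_box_def field_simps
      power2_eq_square)
  finally show ?thesis .
qed

section \<open>The equations of an A-flat metric\<close>

text \<open>
  The three diagonal components share the part \<open>S\<close>, which comes from the terms of \<open>A\<close> that
  are multiples of the metric.
\<close>

lemma A_components:
  fixes \<alpha> \<beta> :: real
  assumes x: "x \<in> sph_chart I"
  defines "r \<equiv> x $ 2"
  defines "S \<equiv> (\<beta> / 2 + 2 * \<alpha>) * scalar_box dR ddR r - \<alpha> / 2 * (2 * p r + 2 * q r)\<^sup>2
     - \<beta> / 2 * (2 * (p r)\<^sup>2 + 2 * (q r)\<^sup>2)"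
  shows "A_tensor \<alpha> \<beta> g 1 1 x = - f r * (\<beta> * scalar_box dp ddp r - (2 * \<alpha> + \<beta>) * (f1 r * dR r / 2)
        + 2 * \<beta> * (sec 1 2 r * p r + 2 * sec 1 3 r * q r) + 2 * \<alpha> * (2 * p r + 2 * q r) * p r + S)"
    (is ?t)
    and "A_tensor \<alpha> \<beta> g 2 2 x = (\<beta> * (scalar_box dp ddp r - 4 * f r * (p r - q r) / r\<^sup>2)
        - (2 * \<alpha> + \<beta>) * (f r * ddR r + f1 r * dR r / 2)
        + 2 * \<beta> * (sec 1 2 r * p r + 2 * sec 1 3 r * q r) + 2 * \<alpha> * (2 * p r + 2 * q r) * p r + S) / f r"
    (is ?r)
    and "A_tensor \<alpha> \<beta> g 3 3 x = r\<^sup>2 * (\<beta> * (scalar_box dq ddq r + 2 * f r * (p r - q r) / r\<^sup>2)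
        - (2 * \<alpha> + \<beta>) * (f r * dR r / r)
        + 2 * \<beta> * (2 * sec 1 3 r * p r + sec 3 4 r * q r) + 2 * \<alpha> * (2 * p r + 2 * q r) * q r + S)"
    (is ?\<theta>)
proof -
  note pos = chartD[OF x, folded r_def]
  have "sec 1 1 r = 0" "sec 2 2 r = 0" "sec 3 3 r = 0" "sec 2 1 r = sec 1 2 r" "sec 4 3 r = sec 3 4 r"
    "sec 3 1 r = sec 1 3 r" "sec 4 1 r = sec 1 3 r" "sec 3 2 r = sec 1 3 r" "sec 4 2 r = sec 1 3 r"
    "sec 2 3 r = sec 1 3 r"
    by (simp_all add: sec_def doubleton_eq_iff)
  then have ric_riem:
    "ric_riem g 1 1 x = (sec 1 2 r * p r + 2 * sec 1 3 r * q r) * (- f r)"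
    "ric_riem g 2 2 x = (sec 1 2 r * p r + 2 * sec 1 3 r * q r) / f r"
    "ric_riem g 3 3 x = (2 * sec 1 3 r * p r + sec 3 4 r * q r) * r\<^sup>2"
    by (simp_all add: ric_riem_component[OF x, folded r_def] sum_4 \<rho>_def g_rad_def g_ang_def)
  have hess: "hess g (scal g) 1 1 x = - (f r * f1 r / 2 * dR r)"
    "hess g (scal g) 2 2 x = ddR r + f1 r / (2 * f r) * dR r"
    "hess g (scal g) 3 3 x = r * f r * dR r"
    by (simp_all add: hess_scal[OF x, folded r_def] \<Gamma>_rad_def \<Gamma>_ang_def)
  have ric: "ric g 1 1 x = - f r * p r" "ric g 2 2 x = p r / f r" "ric g 3 3 x = r\<^sup>2 * q r"
    and metric: "g x $ 1 $ 1 = - f r" "g x $ 2 $ 2 = 1 / f r" "g x $ 3 $ 3 = r\<^sup>2"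
    by (simp_all add: ric_component[OF x, folded r_def] metric_component[OF x, folded r_def]
        \<rho>_def g_rad_def g_ang_def)
  note unf = A_tensor_def box_ric[OF x, folded r_def] box_scal[OF x, folded r_def]
    ric_riem hess scal_eq[OF x, folded r_def] ric metric ric_norm2_eq[OF x, folded r_def] S_def
  show ?t
    unfolding unf by (simp add: field_simps)
  show ?r
    unfolding unf using pos by (simp add: divide_simps) (simp add: algebra_simps)
  show ?\<theta>
    unfolding unf using pos by (simp add: divide_simps) (simp add: algebra_simps power2_eq_square)
qed

text \<open>
  The trace equation is \<open>tt + rr + 2 \<theta>\<theta>\<close> (components with one index raised): the spheres
  contribute twice the \<open>\<theta>\<theta>\<close> component.
\<close>

lemma A_flat_equations:
  fixes \<alpha> \<beta> :: real
  assumes flat: "A_flat_on \<alpha> \<beta> (sph_chart I) g" and r: "r \<in> I"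
  shows A_flat_trace: "(3 * \<alpha> + \<beta>) * scalar_box dR ddR r = 0"
    and A_flat_null: "(2 * \<alpha> + \<beta>) * ddR r = - 4 * \<beta> * (p r - q r) / r\<^sup>2"
    and A_flat_time: "\<beta> = 0 \<Longrightarrow> dR r = 0 \<Longrightarrow> ddR r = 0 \<Longrightarrow> \<alpha> * ((p r + q r) * (p r - q r)) = 0"
proof -
  \<comment> \<open>Any point of the chart over \<open>r\<close> serves; on the equator it is easy to name.\<close>
  define x :: "real ^ 4" where "x = (\<chi> i. if i = 2 then r else if i = 3 then pi / 2 else 0)"
  have x: "x \<in> sph_chart I" "x $ 2 = r"
    using r pi_gt_zero by (auto simp: x_def sph_chart_def)
  have pos: "f r > 0" "r > 0"
    using f_pos[OF r] r_pos[OF r] .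
  define S where "S = (\<beta> / 2 + 2 * \<alpha>) * scalar_box dR ddR r - \<alpha> / 2 * (2 * p r + 2 * q r)\<^sup>2
     - \<beta> / 2 * (2 * (p r)\<^sup>2 + 2 * (q r)\<^sup>2)"
  define Q where "Q = sec 1 2 r * p r + 2 * sec 1 3 r * q r"
  have "A_tensor \<alpha> \<beta> g i j x = 0" for i j
    using flat x(1) by (simp add: A_flat_on_def)
  then have t: "\<beta> * scalar_box dp ddp r - (2 * \<alpha> + \<beta>) * (f1 r * dR r / 2)
        + 2 * \<beta> * Q + 2 * \<alpha> * (2 * p r + 2 * q r) * p r + S = 0"
    and rr: "\<beta> * (scalar_box dp ddp r - 4 * f r * (p r - q r) / r\<^sup>2)
        - (2 * \<alpha> + \<beta>) * (f r * ddR r + f1 r * dR r / 2)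
        + 2 * \<beta> * Q + 2 * \<alpha> * (2 * p r + 2 * q r) * p r + S = 0"
    and \<theta>: "\<beta> * (scalar_box dq ddq r + 2 * f r * (p r - q r) / r\<^sup>2)
        - (2 * \<alpha> + \<beta>) * (f r * dR r / r)
        + 2 * \<beta> * (2 * sec 1 3 r * p r + sec 3 4 r * q r) + 2 * \<alpha> * (2 * p r + 2 * q r) * q r + S = 0"
    using A_components[OF x(1), of \<alpha> \<beta>] pos unfolding x(2) S_def[symmetric] Q_def by simp_all
  \<comment> \<open>Eliminating two sectional curvatures in favour of \<open>p\<close> and \<open>q\<close>, the remaining one cancels
    in the trace.\<close>
  have sec_pq: "sec 1 2 r = p r - 2 * sec 1 3 r" "sec 3 4 r = q r - 2 * sec 1 3 r"
    using pos by (simp_all add: sec_def p_def q_def doubleton_eq_iff field_simps power2_eq_square)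
  have R_box: "scalar_box dR ddR r = 2 * scalar_box dp ddp r + 2 * scalar_box dq ddq r"
    by (simp add: scalar_box_def dR_def ddR_def algebra_simps)
  have box: "f r * ddR r + f1 r * dR r + 2 * (f r * dR r / r) = scalar_box dR ddR r"
    using pos by (simp add: scalar_box_def field_simps)
  show "(3 * \<alpha> + \<beta>) * scalar_box dR ddR r = 0"
  proof -
    define V where "V = f r * (p r - q r) / r\<^sup>2"
    define W where "W = f r * dR r / r"
    have V: "4 * f r * (p r - q r) / r\<^sup>2 = 4 * V" "2 * f r * (p r - q r) / r\<^sup>2 = 2 * V"
      by (simp_all add: V_def)
    note t' = t[unfolded S_def Q_def sec_pq]
      and rr' = rr[unfolded S_def Q_def V sec_pq]
      and \<theta>' = \<theta>[unfolded S_def V sec_pq W_def[symmetric]]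
    have "2 * ((3 * \<alpha> + \<beta>) * scalar_box dR ddR r) = 0"
      using t' rr' \<theta>' R_box box[folded W_def] by algebra
    then show ?thesis by simp
  qed
  have "f r * ((2 * \<alpha> + \<beta>) * ddR r + 4 * \<beta> * (p r - q r) / r\<^sup>2) = 0"
  proof -
    define V where "V = (p r - q r) / r\<^sup>2"
    have V: "4 * f r * (p r - q r) / r\<^sup>2 = 4 * f r * V"
      "4 * \<beta> * (p r - q r) / r\<^sup>2 = 4 * \<beta> * V"
      by (simp_all add: V_def)
    show ?thesis
      unfolding V using t rr[unfolded V] by algebra
  qed
  then show "(2 * \<alpha> + \<beta>) * ddR r = - 4 * \<beta> * (p r - q r) / r\<^sup>2"
    using pos by simp
  assume "\<beta> = 0" "dR r = 0" "ddR r = 0"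
  then show "\<alpha> * ((p r + q r) * (p r - q r)) = 0"
    using t by (simp add: S_def scalar_box_def power2_eq_square) algebra
qed

section \<open>Integration of the constant scalar curvature cases\<close>

text \<open>
  By the Bianchi identity \<open>q\<close> is a constant \<open>\<Lambda>\<close>. The equation
  \<open>(r (1 - f))' = r\<^sup>2 q\<close> can then be integrated.
\<close>

lemma einstein_profile:
  assumes "\<And>r. r \<in> I \<Longrightarrow> p r = q r"
  shows "\<exists>m \<Lambda>. \<forall>r\<in>I. f r = 1 - m / r - \<Lambda> / 3 * r\<^sup>2"
proof -
  obtain \<Lambda> where \<Lambda>: "q r = \<Lambda>" if "r \<in> I" for r
    using constant_of_zero_derivative[OF interval_I, of q] q_derivatives(1) assms by (auto simp: dq_def)
  have "((\<lambda>r. r * (1 - f r) - \<Lambda> / 3 * r ^ 3) has_real_derivative 0) (at r)" if r: "r \<in> I" for r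
    by (rule derivative_eq_intros f'[OF r] refl)+
      (use \<Lambda>[OF r] r_pos[OF r] in \<open>simp add: q_def field_simps power2_eq_square\<close>)
  then obtain m where m: "r * (1 - f r) - \<Lambda> / 3 * r ^ 3 = m" if "r \<in> I" for r
    using constant_of_zero_derivative[OF interval_I, of "\<lambda>r. r * (1 - f r) - \<Lambda> / 3 * r ^ 3"] by auto
  have "f r = 1 - m / r - \<Lambda> / 3 * r\<^sup>2" if r: "r \<in> I" for r
    using m[OF r] r_pos[OF r] by (simp add: field_simps power2_eq_square power3_eq_cube)
  then show ?thesis by blast
qed

text \<open>
  Here \<open>r\<^sup>2 R\<close> is the second derivative of \<open>r\<^sup>2 (1 - f)\<close>.
\<close>

lemma scalar_flat_profile:
  assumes "\<And>r. r \<in> I \<Longrightarrow> p r + q r = 0"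
  shows "\<exists>r0 rQ. \<forall>r\<in>I. f r = 1 - r0 / r - rQ / r\<^sup>2"
proof -
  have "((\<lambda>r. 2 * r * (1 - f r) - r\<^sup>2 * f1 r) has_real_derivative 0) (at r)" if r: "r \<in> I" for r
  proof -
    have "2 * (1 - f r) - 4 * r * f1 r - r\<^sup>2 * f2 r = 2 * r\<^sup>2 * (p r + q r)"
      using r_pos[OF r] by (simp add: p_def q_def field_simps power2_eq_square)
    then have "2 * (1 - f r) - 4 * r * f1 r - r\<^sup>2 * f2 r = 0"
      by (simp add: assms[OF r])
    then show ?thesis
      by - ((rule derivative_eq_intros f'[OF r] f''[OF r] refl)+, simp add: algebra_simps)
  qed
  then obtain r0 where r0: "2 * r * (1 - f r) - r\<^sup>2 * f1 r = r0" if "r \<in> I" for r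
    using constant_of_zero_derivative[OF interval_I, of "\<lambda>r. 2 * r * (1 - f r) - r\<^sup>2 * f1 r"] by auto
  have "((\<lambda>r. r\<^sup>2 * (1 - f r) - r0 * r) has_real_derivative 0) (at r)" if r: "r \<in> I" for r
  proof -
    have "((\<lambda>r. r\<^sup>2 * (1 - f r) - r0 * r) has_real_derivative
        2 * r * (1 - f r) - r\<^sup>2 * f1 r - r0) (at r)"
      by (rule derivative_eq_intros f'[OF r] refl)+ (simp add: algebra_simps)
    then show ?thesis
      by (simp add: r0[OF r])
  qed
  then obtain rQ where rQ: "r\<^sup>2 * (1 - f r) - r0 * r = rQ" if "r \<in> I" for r
    using constant_of_zero_derivative[OF interval_I, of "\<lambda>r. r\<^sup>2 * (1 - f r) - r0 * r"] by auto
  have "f r = 1 - r0 / r - rQ / r\<^sup>2" if r: "r \<in> I" for r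
    unfolding rQ[OF r, symmetric] using r_pos[OF r] by (simp add: field_simps power2_eq_square)
  then show ?thesis by blast
qed

lemma R_derivatives:
  "r \<in> I \<Longrightarrow> ((\<lambda>r. 2 * p r + 2 * q r) has_real_derivative dR r) (at r)"
  "r \<in> I \<Longrightarrow> (dR has_real_derivative ddR r) (at r)"
  unfolding dR_def[abs_def] ddR_def by (intro DERIV_add DERIV_cmult p_derivatives q_derivatives; assumption)+

section \<open>The scalar curvature is constant\<close>

text \<open>
  For functions of \<open>r\<close>, \<open>\<box>\<close> has the divergence form \<open>\<box>F = r\<^sup>-\<^sup>2 (r\<^sup>2 f F')'\<close>.
\<close>

lemma harmonic_first_integral:
  assumes "\<And>r. r \<in> I \<Longrightarrow> scalar_box dR ddR r = 0"
  obtains C where "\<And>r. r \<in> I \<Longrightarrow> r\<^sup>2 * f r * dR r = C"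
proof -
  have "((\<lambda>r. r\<^sup>2 * f r * dR r) has_real_derivative 0) (at r)" if r: "r \<in> I" for r
  proof -
    have "((\<lambda>r. r\<^sup>2 * f r * dR r) has_real_derivative r\<^sup>2 * scalar_box dR ddR r) (at r)"
      by (rule derivative_eq_intros f'[OF r] R_derivatives[OF r] refl)+
        (use r_pos[OF r] in \<open>simp add: scalar_box_def field_simps power2_eq_square\<close>)
    then show ?thesis
      using assms[OF r] by simp
  qed
  then show ?thesis
    using constant_of_zero_derivative[OF interval_I] that by blast
qed

text \<open>
  If the first integral \<open>C\<close> is nonzero, \<open>R'\<close> has no zeros and \<open>y = r R'' / R'\<close> is defined. The
  Riccati equation for \<open>y\<close> comes from \<open>R' = 2 (p - q)' + 8 (p - q) / r\<close>, a form of the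
  Bianchi identity.
\<close>

lemma scal_constant_of_coupled:
  assumes harmonic: "\<And>r. r \<in> I \<Longrightarrow> scalar_box dR ddR r = 0" and "\<kappa> \<noteq> 0"
    and ddR: "\<And>r. r \<in> I \<Longrightarrow> ddR r = \<kappa> * (p r - q r) / r\<^sup>2"
    and r0: "r0 \<in> I"
  shows "dR r0 = 0"
proof (rule ccontr)
  assume "dR r0 \<noteq> 0"
  obtain C where C: "r\<^sup>2 * f r * dR r = C" if "r \<in> I" for r
    using harmonic_first_integral[OF harmonic] by blast
  have "C \<noteq> 0"
    using C[OF r0] \<open>dR r0 \<noteq> 0\<close> f_pos[OF r0] r_pos[OF r0] by auto
  have R1_nz: "dR r \<noteq> 0" if "r \<in> I" for r
    using C[OF that] \<open>C \<noteq> 0\<close> by auto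
  define y where "y r = \<kappa> * (p r - q r) / (r * dR r)" for r
  have u: "\<kappa> * (p r - q r) = y r * r * dR r" if "r \<in> I" for r
    using R1_nz[OF that] r_pos[OF that] by (simp add: y_def)
  have y': "(y has_real_derivative poly [:\<kappa> / 2, -5, -1:] (y r) / r) (at r)" if r: "r \<in> I" for r
  proof -
    have nz: "r \<noteq> 0" "dR r \<noteq> 0" "r * dR r \<noteq> 0"
      using R1_nz[OF r] r_pos[OF r] by auto
    have "(y has_real_derivative (\<kappa> * (dp r - dq r) * (r * dR r)
        - \<kappa> * (p r - q r) * (dR r + r * ddR r)) / (r * dR r)\<^sup>2) (at r)"
      unfolding y_def[abs_def]
      by (rule derivative_eq_intros p_derivatives[OF r] q_derivatives[OF r] R_derivatives[OF r] nz refl)+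
        (simp add: power2_eq_square)
    moreover have "\<kappa> * (dp r - dq r) = \<kappa> * dR r / 2 - 4 * y r * dR r"
    proof -
      have "\<kappa> * (dp r - dq r) = \<kappa> * dR r / 2 - 4 * (\<kappa> * (p r - q r)) / r"
        using nz by (simp add: dR_def dq_def field_simps)
      then show ?thesis
        using nz by (simp add: u[OF r])
    qed
    moreover have "ddR r = y r * dR r / r"
      using ddR[OF r] u[OF r] nz by (simp add: power2_eq_square)
    moreover have "(\<kappa> * dR r / 2 - 4 * y r * dR r) * (r * dR r)
        - y r * r * dR r * (dR r + r * (y r * dR r / r))
      = (\<kappa> / 2 - 5 * y r - (y r)\<^sup>2) / r * (r * dR r)\<^sup>2"
      using nz by (simp add: field_simps power2_eq_square)
    ultimately have "(y has_real_derivative (\<kappa> / 2 - 5 * y r - (y r)\<^sup>2) / r) (at r)"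
      using nz(3) by (simp add: u[OF r])
    then show ?thesis
      by (simp add: power2_eq_square algebra_simps)
  qed
  \<comment> \<open>This is \<open>\<box>R = 0\<close>, read as an equation for \<open>f'\<close>.\<close>
  have f1: "f1 r = - (2 + y r) * f r / r" if r: "r \<in> I" for r
  proof -
    have nz: "r \<noteq> 0" "dR r \<noteq> 0"
      using R1_nz[OF r] r_pos[OF r] by auto
    have "ddR r = y r * dR r / r"
      using ddR[OF r] u[OF r] nz by (simp add: power2_eq_square)
    then have "dR r * (f1 r + (2 + y r) * f r / r) = scalar_box dR ddR r"
      by (simp add: scalar_box_def field_simps add_divide_distrib)
    then have "f1 r + (2 + y r) * f r / r = 0"
      using harmonic[OF r] nz by simp
    then have "f1 r = - ((2 + y r) * f r / r)"
      by linarith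
    then show ?thesis
      by (simp only: minus_mult_left[symmetric] minus_divide_left[symmetric])
  qed
  have f2: "r\<^sup>2 * f2 r = ((2 + y r) * (3 + y r) - poly [:\<kappa> / 2, -5, -1:] (y r)) * f r"
    if r: "r \<in> I" for r
  proof -
    have nz: "r \<noteq> 0"
      using r_pos[OF r] by auto
    have "f2 r = - ((poly [:\<kappa> / 2, -5, -1:] (y r) / r * f r + (2 + y r) * f1 r) * r
        - (2 + y r) * f r) / r\<^sup>2"
    proof (rule derivatives_eq_on_open[OF open_I r f1 f''[OF r]])
      show "((\<lambda>r. - (2 + y r) * f r / r) has_real_derivative
        - ((poly [:\<kappa> / 2, -5, -1:] (y r) / r * f r + (2 + y r) * f1 r) * r
        - (2 + y r) * f r) / r\<^sup>2) (at r)"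
        by (rule derivative_eq_intros f'[OF r] y'[OF r] nz refl)+
          (use nz in \<open>simp add: power2_eq_square field_simps\<close>)
    qed
    then have "r\<^sup>2 * f2 r = - ((poly [:\<kappa> / 2, -5, -1:] (y r) / r * f r
        + (2 + y r) * (- (2 + y r) * f r / r)) * r - (2 + y r) * f r)"
      unfolding f1[OF r, symmetric] using nz by simp
    also have "\<dots> = ((2 + y r) * (3 + y r) - poly [:\<kappa> / 2, -5, -1:] (y r)) * f r"
      using nz by (simp add: field_simps)
    finally show ?thesis .
  qed
  have algebraic: "C * r * y r = - \<kappa> * f r * (poly [:2 - \<kappa> / 4, 5, 1:] (y r) * f r + 1)" if r: "r \<in> I" for r
  proof -
    have nz: "r \<noteq> 0"
      using r_pos[OF r] by auto
    have "C * r * y r = f r * r\<^sup>2 * (\<kappa> * (p r - q r))"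
      unfolding u[OF r] C[OF r, symmetric] by (simp add: ac_simps power2_eq_square)
    \<comment> \<open>Up to here \<open>p - q\<close> was linked to \<open>R'\<close> only; expressing it through \<open>f\<close>
      overdetermines the system.\<close>
    moreover have "r\<^sup>2 * (p r - q r) = f r - 1 - (r\<^sup>2 * f2 r) / 2"
      using nz by (simp add: p_def q_def field_simps power2_eq_square)
    ultimately have "C * r * y r = \<kappa> * f r * (f r - 1 - (r\<^sup>2 * f2 r) / 2)"
      by (simp add: ac_simps)
    then show ?thesis
      unfolding f2[OF r] by (simp add: field_simps)
  qed
  have f_scaling: "(f has_real_derivative - (2 + y r) * f r / r) (at r)" if "r \<in> I" for r
    using f'[OF that] unfolding f1[OF that] .
  show False
    by (rule no_scaling_solution[OF open_I interval_I I_nonempty I_pos \<open>\<kappa> \<noteq> 0\<close> \<open>C \<noteq> 0\<close>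
          f_pos y' f_scaling algebraic])
qed

text \<open>
  A harmonic and affine \<open>R\<close> that is not constant would force \<open>f\<close> to be a multiple of \<open>r\<^sup>-\<^sup>2\<close>;
  but then \<open>R = 2 / r\<^sup>2\<close>.
\<close>

lemma scal_constant_of_affine:
  assumes harmonic: "\<And>r. r \<in> I \<Longrightarrow> scalar_box dR ddR r = 0"
    and ddR: "\<And>r. r \<in> I \<Longrightarrow> ddR r = 0"
    and r0: "r0 \<in> I"
  shows "dR r0 = 0"
proof (rule ccontr)
  assume "dR r0 \<noteq> 0"
  obtain c where c: "dR r = c" if "r \<in> I" for r
    using constant_of_zero_derivative[OF interval_I, of dR] R_derivatives(2) ddR by auto
  have "c \<noteq> 0"
    using c[OF r0] \<open>dR r0 \<noteq> 0\<close> by simp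
  have f1: "f1 r = - 2 * f r / r" if r: "r \<in> I" for r
  proof -
    have "(f1 r + 2 * f r / r) * c = 0"
      using harmonic[OF r] by (simp add: scalar_box_def ddR[OF r] c[OF r])
    then show ?thesis
      using \<open>c \<noteq> 0\<close> by (simp add: eq_neg_iff_add_eq_0)
  qed
  have f2: "f2 r = 6 * f r / r\<^sup>2" if r: "r \<in> I" for r
  proof -
    have nz: "r \<noteq> 0"
      using r_pos[OF r] by auto
    have "f2 r = (- 2 * f1 r * r + 2 * f r) / r\<^sup>2"
    proof (rule derivatives_eq_on_open[OF open_I r f1 f''[OF r]])
      show "((\<lambda>r. - 2 * f r / r) has_real_derivative (- 2 * f1 r * r + 2 * f r) / r\<^sup>2) (at r)"
        by (rule derivative_eq_intros f'[OF r] nz refl)+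
          (use nz in \<open>simp add: power2_eq_square field_simps\<close>)
    qed
    then show ?thesis
      unfolding f1[OF r] using nz by (simp add: field_simps power2_eq_square)
  qed
  have R: "2 * p r + 2 * q r = 2 / r\<^sup>2" if r: "r \<in> I" for r
    unfolding p_def q_def f1[OF r] f2[OF r] using r_pos[OF r]
    by (simp add: field_simps power2_eq_square)
  have dR: "dR r = - 4 / r ^ 3" if r: "r \<in> I" for r
  proof (rule derivatives_eq_on_open[OF open_I r R R_derivatives(1)[OF r]])
    have nz: "r \<noteq> 0" "r\<^sup>2 \<noteq> 0"
      using r_pos[OF r] by auto
    show "((\<lambda>r. 2 / r\<^sup>2) has_real_derivative - 4 / r ^ 3) (at r)"
      by (rule derivative_eq_intros nz refl)+
        (use nz in \<open>simp add: power2_eq_square power3_eq_cube field_simps\<close>)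
  qed
  have "ddR r0 = 12 / r0 ^ 4"
  proof (rule derivatives_eq_on_open[OF open_I r0 dR R_derivatives(2)[OF r0]])
    have nz: "r0 \<noteq> 0" "r0 ^ 3 \<noteq> 0"
      using r_pos[OF r0] by auto
    show "((\<lambda>r. - 4 / r ^ 3) has_real_derivative 12 / r0 ^ 4) (at r0)"
      by (rule derivative_eq_intros nz refl)+
        (use nz in \<open>simp add: power2_eq_square power3_eq_cube power4_eq_xxxx field_simps\<close>)
  qed
  then show False
    using ddR[OF r0] r_pos[OF r0] by simp
qed

lemma A_flat_profile:
  fixes \<alpha> \<beta> :: real
  assumes nz: "3 * \<alpha> + \<beta> \<noteq> 0" and flat: "A_flat_on \<alpha> \<beta> (sph_chart I) g"
  shows "(\<exists>m \<Lambda>. \<forall>r\<in>I. f r = 1 - m / r - \<Lambda> / 3 * r\<^sup>2) \<or>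
    \<beta> = 0 \<and> (\<exists>r0 rQ. \<forall>r\<in>I. f r = 1 - r0 / r - rQ / r\<^sup>2)"
proof -
  have harmonic: "scalar_box dR ddR r = 0" if "r \<in> I" for r
    using A_flat_trace[OF flat that] nz by simp
  note null = A_flat_null[OF flat]
  show ?thesis
  proof (cases "\<beta> = 0")
    case False
    have "p r = q r" if r: "r \<in> I" for r
    proof (cases "2 * \<alpha> + \<beta> = 0")
      case True
      then show ?thesis
        using null[OF r] r_pos[OF r] \<open>\<beta> \<noteq> 0\<close> by simp
    next
      case nz2: False
      define \<kappa> where "\<kappa> = - 4 * \<beta> / (2 * \<alpha> + \<beta>)"
      have "\<kappa> \<noteq> 0"
        using \<open>\<beta> \<noteq> 0\<close> nz2 by (simp add: \<kappa>_def)
      have ddR: "ddR r = \<kappa> * (p r - q r) / r\<^sup>2" if "r \<in> I" for r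
      proof -
        have "ddR r = (2 * \<alpha> + \<beta>) * ddR r / (2 * \<alpha> + \<beta>)"
          using nz2 by simp
        then show ?thesis
          unfolding null[OF that] by (simp add: \<kappa>_def)
      qed
      have "ddR r = 0"
        by (rule derivatives_eq_on_open[OF open_I r _ R_derivatives(2)[OF r] DERIV_const[of 0]])
          (rule scal_constant_of_coupled[OF harmonic \<open>\<kappa> \<noteq> 0\<close> ddR])
      then show ?thesis
        using ddR[OF r] \<open>\<kappa> \<noteq> 0\<close> r_pos[OF r] by simp
    qed
    then show ?thesis
      by (intro disjI1 einstein_profile)
  next
    case True
    then have "\<alpha> \<noteq> 0"
      using nz by simp
    have ddR: "ddR r = 0" if "r \<in> I" for r
      using null[OF that] True \<open>\<alpha> \<noteq> 0\<close> by simp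
    have dR: "dR r = 0" if "r \<in> I" for r
      by (rule scal_constant_of_affine[OF harmonic ddR that])
    have "((\<lambda>r. 2 * p r + 2 * q r) has_real_derivative 0) (at r)" if "r \<in> I" for r
      using R_derivatives(1)[OF that] unfolding dR[OF that] .
    then obtain c where c: "2 * p r + 2 * q r = c" if "r \<in> I" for r
      using constant_of_zero_derivative[OF interval_I] by blast
    have quad: "(p r + q r) * (p r - q r) = 0" if "r \<in> I" for r
      using A_flat_time[OF flat that True dR[OF that] ddR[OF that]] \<open>\<alpha> \<noteq> 0\<close> by simp
    show ?thesis
    proof (cases "c = 0")
      case True
      then have "p r + q r = 0" if "r \<in> I" for r
        using c[OF that] by linarith
      then show ?thesis
        by (intro disjI2 conjI \<open>\<beta> = 0\<close> scalar_flat_profile)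
    next
      case False
      have "p r = q r" if "r \<in> I" for r
      proof -
        have "p r + q r = c / 2"
          using c[OF that] by linarith
        then show ?thesis
          using quad[OF that] False by simp
      qed
      then show ?thesis
        by (intro disjI1 einstein_profile)
    qed
  qed
qed

end

section \<open>Classification of the metrics\<close>

text \<open>
  The components at a point depend on the coefficient functions only through their values there,
  so equalities that hold only on \<open>I\<close> may be used inside the chart.
\<close>

lemma sph_metric_cong:
  "P (x $ 2) = P' (x $ 2) \<Longrightarrow> Q (x $ 2) = Q' (x $ 2) \<Longrightarrow> sph_metric P Q x = sph_metric P' Q' x"
  by (simp add: sph_metric_def vec_eq_iff)

theorem proposition4p1:
  fixes \<alpha> \<beta> :: real and I :: "real set" and a b :: "real \<Rightarrow> real"
  assumes "3 * \<alpha> + \<beta> \<noteq> 0"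
    and "static_spherical I a b"
    and "schwarzschild_form I a b"
    and "A_flat_on \<alpha> \<beta> (sph_chart I) (static_spherical_metric a b)"
  shows "(\<beta> = 0 \<longrightarrow>
            (\<exists>m \<Lambda>. \<forall>x\<in>sph_chart I.
               static_spherical_metric a b x = schwarzschild_de_sitter_metric m \<Lambda> x) \<or>
            (\<exists>r0 rQ. \<forall>x\<in>sph_chart I.
               static_spherical_metric a b x = reissner_nordstrom_metric r0 rQ x)) \<and>
         (\<beta> \<noteq> 0 \<longrightarrow>
            (\<exists>m \<Lambda>. \<forall>x\<in>sph_chart I.
               static_spherical_metric a b x = schwarzschild_de_sitter_metric m \<Lambda> x))"
proof -
  have I: "open I" "is_interval I" "I \<noteq> {}" "I \<subseteq> {0<..}"
    and smooth: "smooth_fun_on I a"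
    using assms(2) by (auto simp: static_spherical_def)
  have a_pos: "a r > 0" if "r \<in> I" for r
    using assms(2) that by (simp add: static_spherical_def)
  have d: "((deriv ^^ k) a has_real_derivative (deriv ^^ Suc k) a r) (at r)" if "r \<in> I" for k r
    using smooth that by (simp add: smooth_fun_on_def DERIV_deriv_iff_field_differentiable)
  define a1 a2 a3 a4 where "a1 = deriv a" and "a2 = (deriv ^^ 2) a"
    and "a3 = (deriv ^^ 3) a" and "a4 = (deriv ^^ 4) a"
  have a': "(a has_real_derivative a1 r) (at r)" "(a1 has_real_derivative a2 r) (at r)"
    "(a2 has_real_derivative a3 r) (at r)" "(a3 has_real_derivative a4 r) (at r)" if "r \<in> I" for r
    using d[OF that, of 0] d[OF that, of 1] d[OF that, of 2] d[OF that, of 3]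
    by (simp_all add: a1_def a2_def a3_def a4_def numeral_eq_Suc)
  \<comment> \<open>Schwarzschild form determines the second coefficient.\<close>
  have b2: "(b r)\<^sup>2 = 1 / (a r)\<^sup>2" if "r \<in> I" for r
  proof -
    have "b r = 1 / a r"
      using assms(3) a_pos[OF that] that
      by (simp add: schwarzschild_form_def field_simps)
    then show ?thesis
      by (simp add: power_one_over)
  qed
  interpret schwarzschild_profile I "\<lambda>r. (a r)\<^sup>2" "\<lambda>r. 2 * a r * a1 r"
    "\<lambda>r. 2 * (a1 r)\<^sup>2 + 2 * a r * a2 r" "\<lambda>r. 6 * a1 r * a2 r + 2 * a r * a3 r"
    "\<lambda>r. 6 * (a2 r)\<^sup>2 + 8 * a1 r * a3 r + 2 * a r * a4 r" "static_spherical_metric a b"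
  proof
    fix x assume "x \<in> sph_chart I"
    then have "x $ 2 \<in> I"
      by (simp add: sph_chart_def)
    then show "static_spherical_metric a b x = sph_metric (\<lambda>r. (a r)\<^sup>2) (\<lambda>r. 1 / (a r)\<^sup>2) x"
      unfolding static_spherical_metric_def by (intro sph_metric_cong b2) simp
  next
    fix r assume r: "r \<in> I"
    show "(a r)\<^sup>2 > 0"
      using a_pos[OF r] by simp
    show "((\<lambda>r. (a r)\<^sup>2) has_real_derivative 2 * a r * a1 r) (at r)"
      by (rule derivative_eq_intros a'[OF r] refl)+ simp
    show "((\<lambda>r. 2 * a r * a1 r) has_real_derivative 2 * (a1 r)\<^sup>2 + 2 * a r * a2 r) (at r)"
      by (rule derivative_eq_intros a'[OF r] refl)+ (simp add: power2_eq_square)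
    show "((\<lambda>r. 2 * (a1 r)\<^sup>2 + 2 * a r * a2 r) has_real_derivative
        6 * a1 r * a2 r + 2 * a r * a3 r) (at r)"
      by (rule derivative_eq_intros a'[OF r] refl)+ (simp add: algebra_simps)
    show "((\<lambda>r. 6 * a1 r * a2 r + 2 * a r * a3 r) has_real_derivative
        6 * (a2 r)\<^sup>2 + 8 * a1 r * a3 r + 2 * a r * a4 r) (at r)"
      by (rule derivative_eq_intros a'[OF r] refl)+ (simp add: algebra_simps power2_eq_square)
  qed (use I in auto)
  have metric_eq: "static_spherical_metric a b x = sph_metric P (\<lambda>r. 1 / P r) x"
    if "\<forall>r\<in>I. (a r)\<^sup>2 = P r" "x \<in> sph_chart I" for P x
    unfolding metric[OF that(2)] using that
    by (intro sph_metric_cong) (simp_all add: sph_chart_def)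
  consider (SdS) m \<Lambda> where "\<forall>r\<in>I. (a r)\<^sup>2 = 1 - m / r - \<Lambda> / 3 * r\<^sup>2"
    | (RN) r0 rQ where "\<beta> = 0" "\<forall>r\<in>I. (a r)\<^sup>2 = 1 - r0 / r - rQ / r\<^sup>2"
    using A_flat_profile[OF assms(1,4)] by blast
  then show ?thesis
  proof cases
    case SdS
    have "\<forall>x\<in>sph_chart I. static_spherical_metric a b x = schwarzschild_de_sitter_metric m \<Lambda> x"
      unfolding schwarzschild_de_sitter_metric_def using metric_eq[OF SdS] by simp
    then show ?thesis by blast
  next
    case RN
    have "\<forall>x\<in>sph_chart I. static_spherical_metric a b x = reissner_nordstrom_metric r0 rQ x"
      unfolding reissner_nordstrom_metric_def using metric_eq[OF RN(2)] by simp
    then show ?thesis using RN(1) by blast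
  qed
qed

end
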